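(* Let $X$ be a separable $L_1$-predual with the Daugavet property and let $Y$ be a finite-dimensional real Hilbert space. If $X\widehat{\otimes}_\pi Y$ has an octahedral norm, then $X\widehat{\otimes}_\pi Y$ has the Daugavet property.
   Context: All Banach spaces are real. A Banach space $X$ is an $L_1$-predual if $X^*$ is isometrically isomorphic to $L_1(\mu)$ for some measure $\mu$. A Banach space $Z$ has the Daugavet property if every rank-one bounded operator $T:Z\to Z$ satisfies $\Vert I+T\Vert=1+\Vert T\Vert$, where $I$ is the identity. A Banach space $Z$ has an octahedral norm if for every finite-dimensional subspace $F$ of $Z$ and every $\varepsilon>0$ there exists $x\in S_Z$ such that $\Vert f+\lambda x\Vert\ge(1-\varepsilon)(\Vert f\Vert+|\lambda|)$ for all $f\in F$, $\lambda\in\mathbb R$. $X\widehat{\otimes}_\pi Y$ is the projective tensor product. *)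

theory Defs
  imports "HOL-Analysis.Analysis"
begin

definition bounded_op :: "('v::real_vector \<Rightarrow> real) \<Rightarrow> ('v \<Rightarrow> 'v) \<Rightarrow> bool" where
  "bounded_op N T \<longleftrightarrow> linear T \<and> (\<exists>K. \<forall>v. N (T v) \<le> K * N v)"

definition op_norm :: "('v::real_vector \<Rightarrow> real) \<Rightarrow> ('v \<Rightarrow> 'v) \<Rightarrow> real" where
  "op_norm N T = Sup {N (T v) | v. N v \<le> 1}"

definition rank_one :: "('v::real_vector \<Rightarrow> 'v) \<Rightarrow> bool" where
  "rank_one T \<longleftrightarrow> dim (range T) = 1"

definition daugavet :: "('v::real_vector \<Rightarrow> real) \<Rightarrow> bool" where
  "daugavet N \<longleftrightarrow> (\<forall>T. bounded_op N T \<and> rank_one T \<longrightarrow>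
      op_norm N (\<lambda>v. v + T v) = 1 + op_norm N T)"

definition octahedral :: "('v::real_vector \<Rightarrow> real) \<Rightarrow> bool" where
  "octahedral N \<longleftrightarrow> (\<forall>F \<epsilon>. (\<exists>B. finite B \<and> F = span B) \<and> \<epsilon> > 0 \<longrightarrow>
      (\<exists>x. N x = 1 \<and> (\<forall>f\<in>F. \<forall>t::real.
          N (f + t *\<^sub>R x) \<ge> (1 - \<epsilon>) * (N f + \<bar>t\<bar>))))"

definition separable_banach :: "'a::real_normed_vector itself \<Rightarrow> bool" where
  "separable_banach _ \<longleftrightarrow> (\<exists>D::'a set. countable D \<and> closure D = UNIV)"

(* X is an L1-predual with witnessing measure M: the dual X* = ('a \<Rightarrow>L real) is
  isometrically isomorphic to L1(M), where L1(M) is the space of integrable real functions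
  modulo a.e. equality (the quotient is unfolded: Phi is linear mod a.e., isometric, and
  surjective mod a.e.). *)
definition L1_predual_wrt :: "'a::real_normed_vector itself \<Rightarrow> 'm measure \<Rightarrow> bool" where
  "L1_predual_wrt _ M \<longleftrightarrow> (\<exists>\<Phi> :: ('a \<Rightarrow>\<^sub>L real) \<Rightarrow> ('m \<Rightarrow> real).
      (\<forall>f. integrable M (\<Phi> f)) \<and>
      (\<forall>f g. AE x in M. \<Phi> (f + g) x = \<Phi> f x + \<Phi> g x) \<and>
      (\<forall>c f. AE x in M. \<Phi> (c *\<^sub>R f) x = c * \<Phi> f x) \<and>
      (\<forall>f. (\<integral>x. \<bar>\<Phi> f x\<bar> \<partial>M) = norm f) \<and>
      (\<forall>g. integrable M g \<longrightarrow> (\<exists>f. AE x in M. \<Phi> f x = g x)))"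

(* Projective tensor product X \<otimes>_\<pi> Y for finite-dimensional Y: the (already complete)
  algebraic tensor product is identified with the linear maps Y \<rightarrow> X via
  a \<otimes> b \<mapsto> (y \<mapsto> \<langle>b,y\<rangle> a); the projective norm is the infimum of
  \<Sum> norm a_k * norm b_k over all representations u = \<Sum> a_k \<otimes> b_k. *)
definition proj_norm :: "('b::euclidean_space \<Rightarrow>\<^sub>L 'a::real_normed_vector) \<Rightarrow> real" where
  "proj_norm u = Inf {(\<Sum>k<m. norm (a k) * norm (b k)) | (m::nat) a b.
      \<forall>y. blinfun_apply u y = (\<Sum>k<m. (b k \<bullet> y) *\<^sub>R a k)}"

end

theory Submission
  imports Defs
begin

text \<open>
  Let \<open>z\<close> have projective norm 1 and let \<open>\<psi>\<close> be a functional on the tensor product, almost attaining its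
  norm at \<open>a \<otimes> y\<close> with \<open>y\<close> a unit vector. We look for \<open>x\<close> in the unit ball of \<open>X\<close> such that \<open>x \<otimes> y\<close> still
  lies in the slice of \<open>\<psi>\<close> and \<open>z + x \<otimes> y\<close> has norm almost 2. Octahedrality, together with
  reflections of \<open>Y\<close>, gives some \<open>x0\<close> for which \<open>z + x0 \<otimes> y\<close> has norm almost 2; take a supporting
  functional \<open>G\<close>, viewed as a map from \<open>Y\<close> to \<open>X*\<close>, that is, as a \<open>Y\<close>-valued integrable function.
  Approximating it by a simple function, \<open>G\<close> is nearly \<open>\<Sum>i. h i \<otimes> c i\<close> with the \<open>h i\<close> isometrically
  equivalent to the unit vectors of an \<open>\<ell>\<close>1 space. Only three scalar properties of the vectors \<open>c i\<close> matter:
  \<open>\<Sum>i. \<bar>b \<bullet> c i\<bar> \<le> norm b\<close> for all \<open>b\<close>, \<open>\<Sum>i. norm (z (c i)) \<approx> 1\<close> and \<open>\<Sum>i. \<bar>y \<bullet> c i\<bar> \<approx> 1\<close>.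
  Indeed the Daugavet property of \<open>X\<close> allows the \<open>h i\<close> to be replaced, one after the other, by functionals
  in the dual ball that norm \<open>z (c i)\<close> and for which \<open>\<psi> (_ \<otimes> y) + \<Sum>i. (y \<bullet> c i) h i\<close> has almost the largest
  conceivable norm. A point \<open>x\<close> almost norming this sum is as required, and the new \<open>\<Sum>i. h i \<otimes> c i\<close> witnesses
  that \<open>z + x \<otimes> y\<close> has norm almost 2.
\<close>

section \<open>Sublinear functionals and the Hahn--Banach theorem\<close>

text \<open>Positive homogeneity is asked only as an inequality, the form in which infima deliver
  it; equality follows by rescaling with the inverse factor.\<close>

definition sublinear :: "('v::real_vector \<Rightarrow> real) \<Rightarrow> bool" where
  "sublinear p \<longleftrightarrow> (\<forall>x y. p (x + y) \<le> p x + p y) \<and> (\<forall>c>0. \<forall>x. p (c *\<^sub>R x) \<le> c * p x) \<and> p 0 = 0"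

lemma sublinear_add: "sublinear p \<Longrightarrow> p (x + y) \<le> p x + p y"
  and sublinear_zero: "sublinear p \<Longrightarrow> p 0 = 0"
  by (auto simp: sublinear_def)

lemma sublinear_scaleR:
  assumes "sublinear p" "c \<ge> 0"
  shows "p (c *\<^sub>R x) = c * p x"
proof (cases "c = 0")
  case False
  then have c: "c > 0" "inverse c > 0" using assms by auto
  then have "p (c *\<^sub>R x) \<le> c * p x" "p (inverse c *\<^sub>R (c *\<^sub>R x)) \<le> inverse c * p (c *\<^sub>R x)"
    using assms(1) unfolding sublinear_def by blast+
  with c show ?thesis by (simp add: field_simps)
qed (use assms in \<open>simp add: sublinear_zero\<close>)

lemma sublinear_neg: "sublinear p \<Longrightarrow> - p (- x) \<le> p x"
  using sublinear_add[of p x "- x"] sublinear_zero[of p] by simp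

text \<open>The infimum of \<open>q (x + t v) - t q v\<close> over \<open>t \<ge> 0\<close> does it:
  \<open>t = 0\<close> gives \<open>r x \<le> q x\<close>, and \<open>t = 1\<close> gives the bound
  at \<open>- v\<close>. The lower bound \<open>- q (- x)\<close> keeps the infimum finite.\<close>

lemma sublinear_shift:
  fixes q :: "'v::real_vector \<Rightarrow> real"
  assumes q: "sublinear q"
  obtains r where "sublinear r" "\<And>x. r x \<le> q x" "r (- v) \<le> - q v"
proof -
  define S where "S x = {q (x + t *\<^sub>R v) - t * q v | t. t \<ge> 0}" for x
  define r where "r x = Inf (S x)" for x
  have low: "- q (- x) \<le> q (x + t *\<^sub>R v) - t * q v" if "t \<ge> 0" for x t
    using sublinear_add[OF q, of "x + t *\<^sub>R v" "- x"] sublinear_scaleR[OF q that, of v] by simp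
  have r_le: "r x \<le> q (x + t *\<^sub>R v) - t * q v" if "t \<ge> 0" for x t
    unfolding r_def S_def
    by (rule cInf_lower) (use that low in \<open>auto simp: bdd_below_def\<close>)
  have r_ge: "z \<le> r x" if "\<And>t. t \<ge> 0 \<Longrightarrow> z \<le> q (x + t *\<^sub>R v) - t * q v" for x z
    unfolding r_def S_def by (rule cInf_greatest) (use that in \<open>auto intro: exI[of _ 0]\<close>)
  have "r (x + y) \<le> r x + r y" for x y
  proof -
    have "r (x + y) - r x \<le> r y"
    proof (rule r_ge)
      fix t :: real assume t: "t \<ge> 0"
      have "r (x + y) - (q (y + t *\<^sub>R v) - t * q v) \<le> r x"
      proof (rule r_ge)
        fix s :: real assume s: "s \<ge> 0"
        show "r (x + y) - (q (y + t *\<^sub>R v) - t * q v) \<le> q (x + s *\<^sub>R v) - s * q v"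
          using r_le[of "s + t" "x + y"] s t sublinear_add[OF q, of "x + s *\<^sub>R v" "y + t *\<^sub>R v"]
          by (simp add: algebra_simps)
      qed
      then show "r (x + y) - r x \<le> q (y + t *\<^sub>R v) - t * q v" by simp
    qed
    then show ?thesis by simp
  qed
  moreover have "r (c *\<^sub>R x) \<le> c * r x" if c: "c > 0" for c x
  proof -
    have "r (c *\<^sub>R x) / c \<le> r x"
    proof (rule r_ge)
      fix t :: real assume "t \<ge> 0"
      then have "r (c *\<^sub>R x) \<le> c * (q (x + t *\<^sub>R v) - t * q v)"
        using r_le[of "c * t" "c *\<^sub>R x"] sublinear_scaleR[OF q, of c "x + t *\<^sub>R v"] c
        by (simp add: algebra_simps)
      with c show "r (c *\<^sub>R x) / c \<le> q (x + t *\<^sub>R v) - t * q v" by (simp add: field_simps)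
    qed
    with c show ?thesis by (simp add: field_simps)
  qed
  moreover have "r 0 = 0"
  proof (rule antisym)
    show "r 0 \<le> 0" using r_le[of 0 0] sublinear_zero[OF q] by simp
    show "0 \<le> r 0" by (rule r_ge) (use sublinear_scaleR[OF q, of _ v] in simp)
  qed
  moreover have "r x \<le> q x" for x using r_le[of 0 x] by simp
  moreover have "r (- v) \<le> - q v" using r_le[of 1 "- v"] sublinear_zero[OF q] by simp
  ultimately show ?thesis using that unfolding sublinear_def by blast
qed

text \<open>The pointwise infimum works: of two members of the chain the smaller one serves both
  summands in the subadditivity estimate. The common bound \<open>p\<close> keeps the infimum
  finite, since every member is at least \<open>- p (- x)\<close> at \<open>x\<close>.\<close>

lemma sublinear_chain_inf:
  fixes C :: "('v::real_vector \<Rightarrow> real) set"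
  assumes ne: "C \<noteq> {}" and C: "\<And>q. q \<in> C \<Longrightarrow> sublinear q" "\<And>q x. q \<in> C \<Longrightarrow> q x \<le> p x"
    and chain: "\<And>q r. q \<in> C \<Longrightarrow> r \<in> C \<Longrightarrow> q \<le> r \<or> r \<le> q"
  obtains u where "sublinear u" "\<And>q. q \<in> C \<Longrightarrow> u \<le> q"
proof -
  define u where "u x = Inf ((\<lambda>q. q x) ` C)" for x
  have low: "- p (- x) \<le> q x" if "q \<in> C" for q x
    using sublinear_neg[of q x] C(1)[OF that] C(2)[OF that, of "- x"] by simp
  have u_le: "u x \<le> q x" if "q \<in> C" for q x
    unfolding u_def by (rule cInf_lower) (use that low in \<open>auto simp: bdd_below_def\<close>)
  have u_ge: "z \<le> u x" if "\<And>q. q \<in> C \<Longrightarrow> z \<le> q x" for x z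
    unfolding u_def by (rule cInf_greatest) (use that ne in auto)
  have "u (x + y) \<le> u x + u y" for x y
  proof -
    have "u (x + y) - u x \<le> u y"
    proof (rule u_ge)
      fix q assume q: "q \<in> C"
      have "u (x + y) - q y \<le> u x"
      proof (rule u_ge)
        fix r assume r: "r \<in> C"
        obtain t where t: "t \<in> C" "t \<le> q" "t \<le> r" using chain[OF q r] q r by blast
        show "u (x + y) - q y \<le> r x"
          using u_le[OF t(1), of "x + y"] sublinear_add[OF C(1)[OF t(1)], of x y]
            le_funD[OF t(2), of y] le_funD[OF t(3), of x] by simp
      qed
      then show "u (x + y) - u x \<le> q y" by simp
    qed
    then show ?thesis by simp
  qed
  moreover have "u (c *\<^sub>R x) \<le> c * u x" if c: "c > 0" for c x
  proof -
    have "u (c *\<^sub>R x) / c \<le> u x"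
    proof (rule u_ge)
      fix q assume "q \<in> C"
      then show "u (c *\<^sub>R x) / c \<le> q x"
        using u_le[of q "c *\<^sub>R x"] sublinear_scaleR[OF C(1), of q c x] c by (simp add: field_simps)
    qed
    with c show ?thesis by (simp add: field_simps)
  qed
  moreover have "u 0 = 0"
  proof (rule antisym)
    obtain q where q: "q \<in> C" using ne by blast
    show "u 0 \<le> 0" using u_le[OF q, of 0] sublinear_zero[OF C(1)[OF q]] by simp
    show "0 \<le> u 0" by (rule u_ge) (simp add: sublinear_zero[OF C(1)])
  qed
  ultimately have "sublinear u" unfolding sublinear_def by blast
  then show ?thesis using that u_le by (simp add: le_fun_def)
qed

text \<open>Shifting cannot lower a minimal \<open>q\<close>, so \<open>q (- v) = - q v\<close>;
  oddness turns subadditivity into additivity and positive homogeneity into homogeneity.\<close>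

lemma minimal_sublinear_linear:
  assumes q: "sublinear q" and min: "\<And>r. sublinear r \<Longrightarrow> r \<le> q \<Longrightarrow> r = q"
  shows "linear q"
proof -
  have neg: "q (- v) = - q v" for v
  proof -
    obtain r where "sublinear r" "\<And>x. r x \<le> q x" "r (- v) \<le> - q v"
      using sublinear_shift[OF q] by blast
    with min[of r] have "q (- v) \<le> - q v" by (auto simp: le_fun_def)
    with sublinear_neg[OF q, of "v"] show ?thesis by simp
  qed
  show ?thesis
  proof
    fix x y show "q (x + y) = q x + q y"
      using sublinear_add[OF q, of x y] sublinear_add[OF q, of "x + y" "- y"] neg[of y] by simp
  next
    fix c x show "q (c *\<^sub>R x) = c *\<^sub>R q x"
      using sublinear_scaleR[OF q, of c x] sublinear_scaleR[OF q, of "- c" x] neg[of "c *\<^sub>R x"]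
      by (cases "c \<ge> 0") auto
  qed
qed

text \<open>Hahn--Banach: a minimal sublinear functional below one that sends \<open>- v\<close> to \<open>- p v\<close>
  is the required linear one.\<close>

theorem hahn_banach_support:
  fixes p :: "'v::real_vector \<Rightarrow> real"
  assumes p: "sublinear p"
  obtains f where "linear f" "\<And>x. f x \<le> p x" "f v = p v"
proof -
  obtain p' where p': "sublinear p'" "\<And>x. p' x \<le> p x" "p' (- v) \<le> - p v"
    using sublinear_shift[OF p] by blast
  define A where "A = {q. sublinear q \<and> q \<le> p'}"
  \<comment> \<open>Zorn's lemma for the reversed pointwise order yields a minimal element; the
    empty chain is bounded by \<open>p'\<close>.\<close>
  have "\<exists>m\<in>A. \<forall>a\<in>A. m \<ge> a \<longrightarrow> a = m"
  proof (rule predicate_Zorn)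
    show "partial_order_on A (relation_of (\<ge>) A)"
      by (rule partial_order_on_relation_ofI) auto
  next
    fix C assume "C \<in> Chains (relation_of (\<ge>) A)"
    then have C: "C \<subseteq> A" "\<And>q r. q \<in> C \<Longrightarrow> r \<in> C \<Longrightarrow> q \<le> r \<or> r \<le> q"
      by (auto simp: Chains_def relation_of_def)
    show "\<exists>u\<in>A. \<forall>a\<in>C. a \<ge> u"
    proof (cases "C = {}")
      case True
      then show ?thesis using p' by (auto simp: A_def)
    next
      case False
      obtain u where u: "sublinear u" "\<And>q. q \<in> C \<Longrightarrow> u \<le> q"
        by (rule sublinear_chain_inf[of C p']) (use False C in \<open>auto simp: A_def le_fun_def\<close>)
      obtain q where "q \<in> C" using False by blast
      then have "u \<le> q" "q \<le> p'" using u(2) C(1) by (auto simp: A_def)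
      then have "u \<le> p'" by (rule order_trans)
      with u show ?thesis by (auto simp: A_def)
    qed
  qed
  then obtain f where f: "f \<in> A" "\<And>a. a \<in> A \<Longrightarrow> a \<le> f \<Longrightarrow> a = f" by blast
  have lin: "linear f"
  proof (rule minimal_sublinear_linear)
    show "sublinear f" using f(1) by (simp add: A_def)
    show "r = f" if "sublinear r" "r \<le> f" for r
      using that f order_trans[of r f p'] by (simp add: A_def)
  qed
  have fp: "f x \<le> p' x" for x using f(1) by (auto simp: A_def le_fun_def)
  have le: "f x \<le> p x" for x using fp p'(2) by (rule order_trans)
  have "f (- v) \<le> - p v" using fp p'(3) by (rule order_trans)
  then have "f v = p v" using le[of v] linear_neg[OF lin, of v] by simp
  with lin le show ?thesis using that by blast
qed

lemma norming_functional:
  fixes x :: "'a::real_normed_vector"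
  obtains h :: "'a \<Rightarrow>\<^sub>L real" where "norm h \<le> 1" "h x = norm x"
proof -
  have "sublinear (norm :: 'a \<Rightarrow> real)" by (auto simp: sublinear_def norm_triangle_ineq)
  then obtain f :: "'a \<Rightarrow> real" where f: "linear f" "\<And>x. f x \<le> norm x" "f x = norm x"
    using hahn_banach_support by blast
  have b: "norm (f y) \<le> 1 * norm y" for y
    using f(2)[of y] f(2)[of "- y"] linear_neg[OF f(1), of y] by (simp add: abs_le_iff)
  have bl: "bounded_linear f"
    using f(1) b by (auto intro!: bounded_linear_intro[of f 1] simp: linear_add linear_scale)
  show ?thesis
    by (rule that[of "Blinfun f"])
      (use f b bl in \<open>auto simp: bounded_linear_Blinfun_apply intro!: norm_blinfun_bound\<close>)
qed

section \<open>The projective norm\<close>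

text \<open>The elementary tensor, under the identification of tensors with maps on the second
  factor that \<open>proj_norm\<close> uses.\<close>

definition tensor :: "'a::real_normed_vector \<Rightarrow> 'b::euclidean_space \<Rightarrow> ('b \<Rightarrow>\<^sub>L 'a)" where
  "tensor a b = blinfun_scaleR_left a o\<^sub>L blinfun_inner_right b"

lemma tensor_apply [simp]: "tensor a b y = (b \<bullet> y) *\<^sub>R a"
  by (simp add: tensor_def)

lemma tensor_simps:
  "tensor (a + a') b = tensor a b + tensor a' b" "tensor (c *\<^sub>R a) b = c *\<^sub>R tensor a b"
  "tensor a (b + b') = tensor a b + tensor a b'" "tensor a (b - b') = tensor a b - tensor a b'"
  "tensor a (c *\<^sub>R b) = c *\<^sub>R tensor a b" "tensor (- a) b = - tensor a b"
  "tensor 0 b = 0" "tensor a 0 = 0"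
  by (auto intro!: blinfun_eqI simp: blinfun.bilinear_simps algebra_simps inner_simps)

lemma tensor_Basis_expansion: "u = (\<Sum>i\<in>Basis. tensor (blinfun_apply u i) i)"
proof (rule blinfun_eqI)
  fix y :: 'a
  have "u y = u (\<Sum>i\<in>Basis. (y \<bullet> i) *\<^sub>R i)" by (simp add: euclidean_representation)
  also have "\<dots> = (\<Sum>i\<in>Basis. tensor (u i) i) y"
    by (simp add: blinfun.sum_right blinfun.sum_left blinfun.scaleR_right inner_commute)
  finally show "u y = (\<Sum>i\<in>Basis. tensor (u i) i) y" .
qed

lemma proj_norm_tensor_eq:
  "proj_norm u = Inf {(\<Sum>k<m. norm (a k) * norm (b k)) | (m::nat) a b. u = (\<Sum>k<m. tensor (a k) (b k))}"
proof -
  have "(\<forall>y. blinfun_apply u y = (\<Sum>k<m. (b k \<bullet> y) *\<^sub>R a k)) \<longleftrightarrow> u = (\<Sum>k<m. tensor (a k) (b k))"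
    for m :: nat and a b
    by (auto simp: blinfun.sum_left intro!: blinfun_eqI)
  then show ?thesis unfolding proj_norm_def by simp
qed

lemma proj_norm_le:
  assumes "u = (\<Sum>k<m. tensor (a k) (b k))"
  shows "proj_norm u \<le> (\<Sum>k<(m::nat). norm (a k) * norm (b k))"
  unfolding proj_norm_tensor_eq
proof (rule cInf_lower)
  show "(\<Sum>k<m. norm (a k) * norm (b k))
    \<in> {(\<Sum>k<m. norm (a k) * norm (b k)) | (m::nat) a b. u = (\<Sum>k<m. tensor (a k) (b k))}"
    using assms by blast
qed (auto intro!: bdd_belowI[of _ 0] sum_nonneg)

text \<open>The expansion along an orthonormal basis shows that representations exist, so a number
  above the infimum is undercut by one of them.\<close>

lemma proj_norm_approx:
  fixes u :: "'b::euclidean_space \<Rightarrow>\<^sub>L 'a::real_normed_vector"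
  assumes "proj_norm u < K"
  obtains m a b where "u = (\<Sum>k<(m::nat). tensor (a k) (b k))" "(\<Sum>k<m. norm (a k) * norm (b k)) < K"
proof -
  define S where "S = {(\<Sum>k<m. norm (a k) * norm (b k)) | (m::nat) a b. u = (\<Sum>k<m. tensor (a k) (b k))}"
  obtain h where h: "bij_betw h {0..<DIM('b)} (Basis :: 'b set)"
    using ex_bij_betw_nat_finite[OF finite_Basis] by blast
  have "u = (\<Sum>k<DIM('b). tensor (u (h k)) (h k))"
    using tensor_Basis_expansion[of u] sum.reindex_bij_betw[OF h, of "\<lambda>i. tensor (u i) i"]
    by (simp add: atLeast0LessThan)
  then have "(\<Sum>k<DIM('b). norm (u (h k)) * norm (h k)) \<in> S"
    unfolding S_def
    by (intro CollectI exI[of _ "DIM('b)"] exI[of _ "\<lambda>k. u (h k)"] exI[of _ h] conjI refl)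
  then have "S \<noteq> {}" by auto
  moreover have "Inf S < K" using assms by (simp only: proj_norm_tensor_eq S_def)
  ultimately obtain r where "r \<in> S" "r < K" using cInf_lessD by blast
  then show ?thesis using that unfolding S_def by (elim CollectE exE conjE) simp
qed

text \<open>Subadditivity along a nearly optimal representation. This is the universal property of
  the projective norm: bounds need checking on elementary tensors only.\<close>

lemma sublinear_le_proj_norm:
  assumes P: "sublinear P" and t: "\<And>a b. P (tensor a b) \<le> norm a * norm b"
  shows "P u \<le> proj_norm u"
proof (rule dense_ge)
  fix K assume "proj_norm u < K"
  then obtain m :: nat and a b where u: "u = (\<Sum>k<m. tensor (a k) (b k))" "(\<Sum>k<m. norm (a k) * norm (b k)) < K"
    by (rule proj_norm_approx) blast
  have "P (\<Sum>k<n. tensor (a k) (b k)) \<le> (\<Sum>k<n. norm (a k) * norm (b k))" for n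
  proof (induction n)
    case (Suc n)
    then show ?case
      using sublinear_add[OF P, of "\<Sum>k<n. tensor (a k) (b k)" "tensor (a n) (b n)"] t[of "a n" "b n"]
      by simp
  qed (simp add: sublinear_zero[OF P])
  from this[of m] show "P u \<le> K" using u by simp
qed

lemma linear_imp_sublinear: "linear f \<Longrightarrow> sublinear f"
  by (simp add: sublinear_def linear_add linear_scale linear_0)

lemma norm_tensor_le: "norm (tensor a b) \<le> norm a * norm b"
proof (rule norm_blinfun_bound)
  show "norm (tensor a b y) \<le> norm a * norm b * norm y" for y
    using mult_left_mono[OF Cauchy_Schwarz_ineq2[of b y], of "norm a"] by (simp add: mult_ac)
qed simp

lemma norm_le_proj_norm: "norm u \<le> proj_norm u"
  by (rule sublinear_le_proj_norm) (auto simp: sublinear_def norm_triangle_ineq norm_tensor_le)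

lemma proj_norm_nonneg: "0 \<le> proj_norm u"
  using norm_le_proj_norm[of u] norm_ge_zero[of u] by linarith

lemma proj_norm_eq_0D: "proj_norm u \<le> 0 \<Longrightarrow> u = 0"
  using order_trans[OF norm_le_proj_norm, of u 0] by simp

lemma proj_norm_tensor_le: "proj_norm (tensor a b) \<le> norm a * norm b"
  using proj_norm_le[of "tensor a b" "\<lambda>_. a" "\<lambda>_. b" 1] by simp

lemma sum_lessThan_add:
  fixes f :: "nat \<Rightarrow> 'c::comm_monoid_add"
  shows "(\<Sum>k<m + n. f k) = (\<Sum>k<m. f k) + (\<Sum>k<n. f (m + k))"
  by (induction n) (simp_all add: add.assoc)

text \<open>Concatenating nearly optimal representations of \<open>u\<close> and \<open>v\<close>
  gives subadditivity; scaling the first factors gives homogeneity.\<close>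

lemma sublinear_proj_norm:
  "sublinear (proj_norm :: ('b::euclidean_space \<Rightarrow>\<^sub>L 'a::real_normed_vector) \<Rightarrow> real)"
proof -
  have "proj_norm (u + v) \<le> proj_norm u + proj_norm v" for u v :: "'b \<Rightarrow>\<^sub>L 'a"
  proof -
    have "proj_norm (u + v) - proj_norm v \<le> K" if K: "proj_norm u < K" for K
    proof -
      have "proj_norm (u + v) - K \<le> L" if L: "proj_norm v < L" for L
      proof -
        obtain m :: nat and a b where u: "u = (\<Sum>k<m. tensor (a k) (b k))" "(\<Sum>k<m. norm (a k) * norm (b k)) < K"
          by (rule proj_norm_approx[OF K]) blast
        obtain n :: nat and a' b' where v: "v = (\<Sum>k<n. tensor (a' k) (b' k))" "(\<Sum>k<n. norm (a' k) * norm (b' k)) < L"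
          by (rule proj_norm_approx[OF L]) blast
        define a'' b'' where "a'' k = (if k < m then a k else a' (k - m))"
          and "b'' k = (if k < m then b k else b' (k - m))" for k
        have "u + v = (\<Sum>k<m + n. tensor (a'' k) (b'' k))"
          unfolding sum_lessThan_add u v by (simp add: a''_def b''_def)
        from proj_norm_le[OF this] u(2) v(2) show ?thesis
          unfolding sum_lessThan_add by (simp add: a''_def b''_def)
      qed
      then have "proj_norm (u + v) - K \<le> proj_norm v" by (rule dense_ge)
      then show ?thesis by simp
    qed
    then have "proj_norm (u + v) - proj_norm v \<le> proj_norm u" by (rule dense_ge)
    then show ?thesis by simp
  qed
  moreover have "proj_norm (c *\<^sub>R u) \<le> c * proj_norm u" if c: "c > 0" for c and u :: "'b \<Rightarrow>\<^sub>L 'a"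
  proof -
    have "proj_norm (c *\<^sub>R u) / c \<le> K" if K: "proj_norm u < K" for K
    proof -
      obtain m :: nat and a b where u: "u = (\<Sum>k<m. tensor (a k) (b k))" "(\<Sum>k<m. norm (a k) * norm (b k)) < K"
        by (rule proj_norm_approx[OF K]) blast
      have "c *\<^sub>R u = (\<Sum>k<m. tensor (c *\<^sub>R a k) (b k))"
        unfolding u by (simp add: scaleR_sum_right tensor_simps)
      from proj_norm_le[OF this] have "proj_norm (c *\<^sub>R u) \<le> c * (\<Sum>k<m. norm (a k) * norm (b k))"
        using c by (simp add: sum_distrib_left mult.assoc)
      also have "\<dots> \<le> c * K" using u(2) c by simp
      finally show ?thesis using c by (simp add: field_simps)
    qed
    then have "proj_norm (c *\<^sub>R u) / c \<le> proj_norm u" by (rule dense_ge)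
    then show ?thesis using c by (simp add: field_simps)
  qed
  moreover have "proj_norm (0 :: 'b \<Rightarrow>\<^sub>L 'a) = 0"
    using proj_norm_tensor_le[of "0::'a" "0::'b"] proj_norm_nonneg[of "0 :: 'b \<Rightarrow>\<^sub>L 'a"]
    by (simp add: tensor_simps)
  ultimately show ?thesis unfolding sublinear_def by blast
qed

lemmas proj_norm_add = sublinear_add[OF sublinear_proj_norm]
  and proj_norm_scaleR_nonneg = sublinear_scaleR[OF sublinear_proj_norm]
  and proj_norm_zero = sublinear_zero[OF sublinear_proj_norm]

lemma proj_norm_minus:
  fixes u :: "'b::euclidean_space \<Rightarrow>\<^sub>L 'a::real_normed_vector"
  shows "proj_norm (- u) = proj_norm u"
proof -
  have "proj_norm (- v) \<le> proj_norm v" for v :: "'b \<Rightarrow>\<^sub>L 'a"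
  proof (rule dense_ge)
    fix K assume "proj_norm v < K"
    then obtain m :: nat and a b where u: "v = (\<Sum>k<m. tensor (a k) (b k))" "(\<Sum>k<m. norm (a k) * norm (b k)) < K"
      by (rule proj_norm_approx) blast
    have "- v = (\<Sum>k<m. tensor (- a k) (b k))"
      unfolding u by (simp add: sum_negf tensor_simps)
    from proj_norm_le[OF this] u(2) show "proj_norm (- v) \<le> K" by simp
  qed
  from this[of u] this[of "- u"] show ?thesis by simp
qed

lemma proj_norm_scaleR:
  fixes u :: "'b::euclidean_space \<Rightarrow>\<^sub>L 'a::real_normed_vector"
  shows "proj_norm (c *\<^sub>R u) = \<bar>c\<bar> * proj_norm u"
proof (cases "c \<ge> 0")
  case True
  then show ?thesis using proj_norm_scaleR_nonneg[of c u] by simp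
next
  case False
  then have "proj_norm ((- c) *\<^sub>R u) = (- c) * proj_norm u"
    by (intro proj_norm_scaleR_nonneg) simp
  then show ?thesis using False proj_norm_minus[of "c *\<^sub>R u"] by (simp only: scaleR_minus_left)
qed

section \<open>Convex functions on the projective unit ball\<close>

lemma convex_on_proj_norm_translate:
  fixes u :: "'b::euclidean_space \<Rightarrow>\<^sub>L 'a::real_normed_vector"
  shows "convex_on UNIV (\<lambda>v. proj_norm (u + v))"
proof (rule convex_onI)
  fix t :: real and x y :: "'b \<Rightarrow>\<^sub>L 'a" assume t: "0 < t" "t < 1"
  have "u + ((1 - t) *\<^sub>R x + t *\<^sub>R y) = ((1 - t) + t) *\<^sub>R u + ((1 - t) *\<^sub>R x + t *\<^sub>R y)" by simp
  also have "\<dots> = (1 - t) *\<^sub>R (u + x) + t *\<^sub>R (u + y)"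
    by (simp only: scaleR_add_left scaleR_add_right ac_simps)
  finally have "proj_norm (u + ((1 - t) *\<^sub>R x + t *\<^sub>R y))
      \<le> proj_norm ((1 - t) *\<^sub>R (u + x)) + proj_norm (t *\<^sub>R (u + y))"
    by (simp only: proj_norm_add)
  also have "\<dots> = (1 - t) * proj_norm (u + x) + t * proj_norm (u + y)"
    using t by (simp only: proj_norm_scaleR abs_of_pos diff_gt_0_iff_gt)
  finally show "proj_norm (u + ((1 - t) *\<^sub>R x + t *\<^sub>R y))
      \<le> (1 - t) * proj_norm (u + x) + t * proj_norm (u + y)" .
qed simp

lemma scaleR_norm_sgn: "norm x *\<^sub>R sgn x = (x :: 'c::real_normed_vector)"
  by (cases "x = 0") (simp_all add: sgn_div_norm)

text \<open>The open unit ball of the projective norm is contained in the convex hull of the elementary tensors.\<close>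

lemma convex_le_on_proj_ball:
  fixes g :: "('b::euclidean_space \<Rightarrow>\<^sub>L 'a::real_normed_vector) \<Rightarrow> real"
  assumes g: "convex_on UNIV g" and v: "proj_norm v < 1"
    and C: "\<And>a b. norm a \<le> 1 \<Longrightarrow> norm b = 1 \<Longrightarrow> g (tensor a b) \<le> C"
  shows "g v \<le> C"
proof -
  obtain m :: nat and a b where u: "v = (\<Sum>k<m. tensor (a k) (b k))" "(\<Sum>k<m. norm (a k) * norm (b k)) < 1"
    by (rule proj_norm_approx[OF v]) blast
  \<comment> \<open>The extra index \<open>m\<close> carries the slack in the norm as weight and 0
    as point, which makes the weights sum to 1.\<close>
  define l where "l k = (if k < m then norm (a k) * norm (b k) else 1 - (\<Sum>k<m. norm (a k) * norm (b k)))" for k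
  define e where "e k = (if k < m then tensor (sgn (a k)) (sgn (b k)) else 0)" for k
  \<comment> \<open>The value at 0 is needed for the extra index and for terms with
    \<open>b k = 0\<close>, where \<open>sgn (b k)\<close> is not a unit vector.\<close>
  have g0: "g 0 \<le> C" using C[of 0 "SOME i. i \<in> Basis"] by (simp add: tensor_simps)
  have le: "l k *\<^sub>R e k = tensor (a k) (b k)" if "k < m" for k
  proof -
    have "l k *\<^sub>R e k = tensor (norm (a k) *\<^sub>R sgn (a k)) (norm (b k) *\<^sub>R sgn (b k))"
      using that by (simp add: l_def e_def tensor_simps(2,5))
    then show ?thesis by (simp add: scaleR_norm_sgn)
  qed
  have "(\<Sum>k<Suc m. l k *\<^sub>R e k) = (\<Sum>k<m. l k *\<^sub>R e k)" by (simp add: e_def)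
  also have "\<dots> = v" unfolding u(1) by (intro sum.cong refl le) simp
  finally have "g v = g (\<Sum>k<Suc m. l k *\<^sub>R e k)" by simp
  also have "\<dots> \<le> (\<Sum>k<Suc m. l k * g (e k))"
  proof (rule convex_on_sum[OF _ _ g])
    show "(\<Sum>k<Suc m. l k) = 1" by (simp add: l_def)
    show "0 \<le> l k" for k using u(2) by (auto simp: l_def)
  qed auto
  also have "\<dots> \<le> (\<Sum>k<Suc m. l k * C)"
  proof (intro sum_mono mult_left_mono)
    fix k
    show "0 \<le> l k" using u(2) by (auto simp: l_def)
    show "g (e k) \<le> C"
    proof (cases "k < m \<and> b k \<noteq> 0")
      case True
      then show ?thesis using C[of "sgn (a k)" "sgn (b k)"] by (simp add: e_def norm_sgn)
    next
      case False
      then have "e k = 0" by (auto simp: e_def tensor_simps)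
      then show ?thesis using g0 by simp
    qed
  qed
  also have "\<dots> = (\<Sum>k<Suc m. l k) * C" by (rule sum_distrib_right[symmetric])
  also have "\<dots> = C" by (simp add: l_def)
  finally show ?thesis .
qed

text \<open>The reflection in the hyperplane orthogonal to \<open>v\<close>; the identity for \<open>v = 0\<close>, since then
  the quotient is 0.\<close>

definition hreflect :: "'b::euclidean_space \<Rightarrow> 'b \<Rightarrow> 'b" where
  "hreflect v y = y - (2 / (v \<bullet> v) * (v \<bullet> y)) *\<^sub>R v"

lemma linear_hreflect: "linear (hreflect v)"
  by (rule linearI)
    (simp_all add: hreflect_def inner_add_right distrib_left add_divide_distrib scaleR_add_left scaleR_diff_right mult_ac)

lemma hreflect_involution: "hreflect v (hreflect v y) = y"
proof (cases "v = 0")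
  case False
  then have "v \<bullet> hreflect v y = - (v \<bullet> y)"
    by (simp add: hreflect_def inner_diff_right)
  then have "hreflect v (hreflect v y) = hreflect v y + (2 / (v \<bullet> v) * (v \<bullet> y)) *\<^sub>R v"
    by (simp add: hreflect_def[of v "hreflect v y"])
  then show ?thesis by (simp add: hreflect_def)
qed (simp add: hreflect_def)

lemma hreflect_self_adjoint: "hreflect v x \<bullet> y = x \<bullet> hreflect v y"
  by (simp add: hreflect_def inner_diff_left inner_diff_right inner_commute[of x v])

lemma norm_hreflect: "norm (hreflect v y) = norm y"
  by (simp add: norm_eq_sqrt_inner hreflect_self_adjoint hreflect_involution)

text \<open>Equal norms give \<open>2 * ((x - y) \<bullet> x) = (x - y) \<bullet> (x - y)\<close>,
  so exactly one copy of \<open>x - y\<close> is subtracted from \<open>x\<close>.\<close>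

lemma hreflect_swap:
  assumes "norm x = norm y"
  shows "hreflect (x - y) x = y"
proof (cases "x = y")
  case False
  have "x \<bullet> x = y \<bullet> y" using assms by (simp add: dot_square_norm)
  then have "2 * ((x - y) \<bullet> x) = (x - y) \<bullet> (x - y)"
    by (simp add: inner_diff_left inner_diff_right inner_commute[of y x])
  moreover have "(x - y) \<bullet> (x - y) \<noteq> 0" using False by simp
  ultimately have "2 / ((x - y) \<bullet> (x - y)) * ((x - y) \<bullet> x) = 1" by simp
  then show ?thesis unfolding hreflect_def by (simp only: scaleR_one) simp
qed (simp add: hreflect_def)

definition breflect :: "'b::euclidean_space \<Rightarrow> ('b \<Rightarrow>\<^sub>L 'b)" where
  "breflect v = Blinfun (hreflect v)"

lemma breflect_apply [simp]: "breflect v y = hreflect v y"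
  unfolding breflect_def
  by (simp add: bounded_linear_Blinfun_apply linear_linear linear_hreflect)

text \<open>By self-adjointness the reflection moves onto the second factors of a representation and
  preserves their norms; the involution gives the reverse inequality.\<close>

lemma proj_norm_breflect:
  fixes u :: "'b::euclidean_space \<Rightarrow>\<^sub>L 'a::real_normed_vector"
  shows "proj_norm (u o\<^sub>L breflect v) = proj_norm u"
proof -
  have le: "proj_norm (w o\<^sub>L breflect v) \<le> proj_norm w" for w :: "'b \<Rightarrow>\<^sub>L 'a"
  proof (rule dense_ge)
    fix K assume "proj_norm w < K"
    then obtain m :: nat and a b where u: "w = (\<Sum>k<m. tensor (a k) (b k))" "(\<Sum>k<m. norm (a k) * norm (b k)) < K"
      by (rule proj_norm_approx) blast
    have "w o\<^sub>L breflect v = (\<Sum>k<m. tensor (a k) (hreflect v (b k)))"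
      by (rule blinfun_eqI) (simp add: u(1) blinfun.sum_left hreflect_self_adjoint)
    from proj_norm_le[OF this] u(2) show "proj_norm (w o\<^sub>L breflect v) \<le> K"
      by (simp add: norm_hreflect)
  qed
  have "(u o\<^sub>L breflect v) o\<^sub>L breflect v = u"
    by (rule blinfun_eqI) (simp add: hreflect_involution)
  with le[of u] le[of "u o\<^sub>L breflect v"] show ?thesis by simp
qed

section \<open>Octahedrality and the Daugavet property in terms of functionals\<close>

text \<open>Octahedrality only provides some direction in the second factor. Applying it to the finitely
  many tensors obtained from \<open>z\<close> by reflecting a net of the sphere onto \<open>y1\<close> makes that direction irrelevant.\<close>

lemma octahedral_reflected_tensor:
  fixes z :: "'b::euclidean_space \<Rightarrow>\<^sub>L 'a::real_normed_vector"
  assumes oct: "octahedral (proj_norm :: ('b \<Rightarrow>\<^sub>L 'a) \<Rightarrow> real)"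
    and z: "proj_norm z = 1" and y1: "norm y1 = 1" and \<delta>: "\<delta> > 0"
  obtains x y v where "norm x \<le> 1" "norm y = 1" "hreflect v y = y1"
    "proj_norm ((z o\<^sub>L breflect v) + tensor x y) > 2 - \<delta>"
proof -
  have "\<forall>e>0. \<exists>k. finite k \<and> k \<subseteq> sphere (0::'b) 1 \<and> sphere 0 1 \<subseteq> (\<Union>x\<in>k. ball x e)"
    by (intro seq_compact_imp_totally_bounded compact_imp_seq_compact compact_sphere)
  then obtain D where D: "finite D" "D \<subseteq> sphere (0::'b) 1" "sphere 0 1 \<subseteq> (\<Union>x\<in>D. ball x (\<delta>/2))"
    using \<delta> by (meson half_gt_zero)
  define m where "m = real (card D)"
  have "y1 \<in> (\<Union>x\<in>D. ball x (\<delta>/2))" using subsetD[OF D(3), of y1] y1 by simp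
  then have "D \<noteq> {}" by auto
  then have "card D > 0" using D(1) by (simp add: card_gt_0_iff)
  then have m: "m \<ge> 1" unfolding m_def by linarith
  \<comment> \<open>For a net point \<open>d\<close> this reflection exchanges \<open>d\<close> and
    \<open>y1\<close>.\<close>
  define f where "f d = z o\<^sub>L breflect (d - y1)" for d
  have Nf: "proj_norm (f d) = 1" for d by (simp add: f_def proj_norm_breflect z)
  \<comment> \<open>With \<open>8 * (m * \<eta>) \<le> \<delta>\<close> the total loss
    \<open>3 * (m * \<eta>)\<close> over the net stays below \<open>\<delta>/2\<close>.\<close>
  define \<eta> where "\<eta> = min (1/2) (\<delta> / (8 * m))"
  have \<eta>: "\<eta> > 0" "\<eta> \<le> 1/2" using \<delta> m by (auto simp: \<eta>_def)
  have "\<eta> \<le> \<delta> / (8 * m)" by (simp add: \<eta>_def)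
  then have \<eta>m: "8 * (m * \<eta>) \<le> \<delta>" using m by (simp add: field_simps)
  have "\<exists>B. finite B \<and> span (f ` D) = span B" using D(1) by blast
  then obtain v where v: "proj_norm v = 1"
    "\<And>u t. u \<in> span (f ` D) \<Longrightarrow> proj_norm (u + t *\<^sub>R v) \<ge> (1 - \<eta>) * (proj_norm u + \<bar>t\<bar>)"
    using oct \<eta>(1) unfolding octahedral_def by metis
  \<comment> \<open>One convex function controls all reflected copies at once: every summand is at
    most 2 on elementary tensors of norm at most 1, so a sum close to \<open>2 * m\<close> makes
    each summand close to 2.\<close>
  define g where "g w = (\<Sum>d\<in>D. proj_norm (f d + w))" for w
  have g: "convex_on UNIV g"
  proof (rule convex_onI)
    fix t :: real and x y :: "'b \<Rightarrow>\<^sub>L 'a" assume t: "0 < t" "t < 1"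
    have "g ((1 - t) *\<^sub>R x + t *\<^sub>R y) \<le> (\<Sum>d\<in>D. (1 - t) * proj_norm (f d + x) + t * proj_norm (f d + y))"
      unfolding g_def
    proof (rule sum_mono)
      fix d
      show "proj_norm (f d + ((1 - t) *\<^sub>R x + t *\<^sub>R y))
          \<le> (1 - t) * proj_norm (f d + x) + t * proj_norm (f d + y)"
        using convex_onD[OF convex_on_proj_norm_translate[of "f d"], of t x y] t by simp
    qed
    also have "\<dots> = (1 - t) * g x + t * g y"
      by (simp only: g_def sum.distrib sum_distrib_left)
    finally show "g ((1 - t) *\<^sub>R x + t *\<^sub>R y) \<le> (1 - t) * g x + t * g y" .
  qed simp
  have "\<exists>a b. norm a \<le> 1 \<and> norm b = 1 \<and> g (tensor a b) > 2 * m - \<delta>/2"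
  proof (rule ccontr)
    assume "\<not> ?thesis"
    then have C: "g (tensor a b) \<le> 2 * m - \<delta>/2" if "norm a \<le> 1" "norm b = 1" for a b
      using that by (meson not_le)
    \<comment> \<open>The factor \<open>1 - \<eta>\<close> moves \<open>v\<close> into the open unit
      ball, where convexity reduces to elementary tensors.\<close>
    have "proj_norm ((1 - \<eta>) *\<^sub>R v) < 1" using \<eta> v(1) by (simp add: proj_norm_scaleR)
    from convex_le_on_proj_ball[OF g this C]
    have le: "g ((1 - \<eta>) *\<^sub>R v) \<le> 2 * m - \<delta>/2" by simp
    have "(2 - 3 * \<eta>) * m = (\<Sum>d\<in>D. 2 - 3 * \<eta>)" by (simp add: m_def)
    also have "\<dots> \<le> g ((1 - \<eta>) *\<^sub>R v)"
      unfolding g_def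
    proof (rule sum_mono)
      fix d assume "d \<in> D"
      then have "f d \<in> span (f ` D)" by (intro span_base imageI)
      from v(2)[OF this, of "1 - \<eta>"] have "proj_norm (f d + (1 - \<eta>) *\<^sub>R v) \<ge> (1 - \<eta>) * (2 - \<eta>)"
        using \<eta> by (simp add: Nf)
      moreover have "(1 - \<eta>) * (2 - \<eta>) = 2 - 3 * \<eta> + \<eta> * \<eta>" by (simp add: algebra_simps)
      moreover have "0 \<le> \<eta> * \<eta>" by simp
      ultimately show "2 - 3 * \<eta> \<le> proj_norm (f d + (1 - \<eta>) *\<^sub>R v)" by linarith
    qed
    finally have "2 * m - 3 * (m * \<eta>) \<le> 2 * m - \<delta>/2" using le by (simp add: algebra_simps)
    then show False using \<eta>m \<delta> by linarith
  qed
  then obtain a b where ab: "norm a \<le> 1" "norm b = 1" "g (tensor a b) > 2 * m - \<delta>/2" by blast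
  have Nab: "proj_norm (tensor a d) \<le> norm d" for d :: 'b
    using proj_norm_tensor_le[of a d] mult_right_mono[OF ab(1), of "norm d"] by simp
  have "b \<in> (\<Union>x\<in>D. ball x (\<delta>/2))" using subsetD[OF D(3), of b] ab(2) by simp
  then obtain d where d: "d \<in> D" "dist d b < \<delta>/2" by auto
  have "(\<Sum>d'\<in>D - {d}. proj_norm (f d' + tensor a b)) \<le> (\<Sum>d'\<in>D - {d}. 2)"
  proof (rule sum_mono)
    fix d'
    show "proj_norm (f d' + tensor a b) \<le> 2"
      using proj_norm_add[of "f d'" "tensor a b"] Nf[of d'] Nab[of b] ab(2) by simp
  qed
  also have "\<dots> = 2 * (m - 1)"
    using D(1) d(1) \<open>card D > 0\<close> by (simp add: m_def card_Diff_singleton of_nat_diff)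
  finally have "proj_norm (f d + tensor a b) > 2 - \<delta>/2"
    using ab(3) sum.remove[OF D(1) d(1), of "\<lambda>d. proj_norm (f d + tensor a b)"] by (simp add: g_def)
  \<comment> \<open>Moving from \<open>b\<close> to the net point \<open>d\<close> costs less than
    \<open>\<delta>/2\<close>.\<close>
  moreover have "f d + tensor a b = (f d + tensor a d) + tensor a (b - d)"
    by (simp add: tensor_simps(4))
  then have "proj_norm (f d + tensor a b) \<le> proj_norm (f d + tensor a d) + proj_norm (tensor a (b - d))"
    by (simp only: proj_norm_add)
  moreover have "proj_norm (tensor a (b - d)) < \<delta>/2"
    using Nab[of "b - d"] d(2) by (simp add: dist_norm norm_minus_commute)
  ultimately have "proj_norm (f d + tensor a d) > 2 - \<delta>" by linarith
  moreover have nd: "norm d = 1" using D(2) d(1) by auto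
  moreover have "hreflect (d - y1) d = y1" by (rule hreflect_swap) (simp add: nd y1)
  ultimately show ?thesis using that[where x = a and y = d and v = "d - y1"] ab(1) by (simp add: f_def)
qed

section \<open>The Daugavet property of the first factor in terms of functionals\<close>

lemma blinfun_norm_witness:
  fixes \<phi> :: "'a::real_normed_vector \<Rightarrow>\<^sub>L real"
  assumes "s < norm \<phi>"
  obtains x where "norm x \<le> 1" "\<phi> x > s"
proof -
  have "\<exists>x. norm x \<le> 1 \<and> \<phi> x > s"
  proof (rule ccontr)
    assume "\<not> ?thesis"
    then have le: "\<phi> x \<le> s" if "norm x \<le> 1" for x using that by (meson not_le)
    have s: "0 \<le> s" using le[of 0] by simp
    have "norm \<phi> \<le> s"
    proof (rule norm_blinfun_bound[OF s])
      fix x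
      have "\<phi> (sgn x) \<le> s" "\<phi> (- sgn x) \<le> s" by (intro le; simp add: norm_sgn)+
      then have "\<bar>\<phi> (sgn x)\<bar> \<le> s" by (simp add: blinfun.minus_right)
      moreover have "\<phi> x = norm x * \<phi> (sgn x)"
        using blinfun.scaleR_right[of \<phi> "norm x" "sgn x"] by (simp add: scaleR_norm_sgn)
      ultimately show "norm (\<phi> x) \<le> s * norm x"
        using mult_right_mono[of "\<bar>\<phi> (sgn x)\<bar>" s "norm x"] by (simp add: abs_mult mult.commute)
    qed
    then show False using assms by simp
  qed
  then show ?thesis using that by blast
qed

lemma blinfun_le_norm:
  fixes \<phi> :: "'a::real_normed_vector \<Rightarrow>\<^sub>L real"
  assumes "norm x \<le> 1"
  shows "\<bar>\<phi> x\<bar> \<le> norm \<phi>"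
  using norm_blinfun[of \<phi> x] mult_left_mono[OF assms, of "norm \<phi>"] by simp

lemma dim_range_functional_scaleR:
  fixes u :: "'v::real_vector"
  assumes "u \<noteq> 0" and v: "\<phi> v = (1::real)" and lin: "\<And>c v. \<phi> (c *\<^sub>R v) = c * \<phi> (v::'w::real_vector)"
  shows "dim (range (\<lambda>x. \<phi> x *\<^sub>R u)) = 1"
proof -
  have "range (\<lambda>x. \<phi> x *\<^sub>R u) = span {u}"
  proof -
    have "range (\<lambda>x. \<phi> x *\<^sub>R u) = range (\<lambda>k. k *\<^sub>R u)"
    proof (intro equalityI subsetI)
      fix y assume "y \<in> range (\<lambda>k. k *\<^sub>R u)"
      then obtain k where "y = k *\<^sub>R u" by blast
      then have "y = \<phi> (k *\<^sub>R v) *\<^sub>R u" using v lin by simp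
      then show "y \<in> range (\<lambda>x. \<phi> x *\<^sub>R u)" by (rule range_eqI)
    qed auto
    then show ?thesis by (simp add: span_singleton)
  qed
  then show ?thesis using assms(1) by (simp add: dim_eq_card_independent)
qed

text \<open>The operator sending \<open>x\<close> to \<open>\<phi> x\<close> times \<open>w\<close>
  has norm 1, so some \<open>x\<close> makes the norm of \<open>x + T x\<close> almost 2. If
  \<open>h\<close> norms this vector, then \<open>h x + \<phi> x * h w\<close> is almost 2 with both
  terms at most 1, so both are almost 1. Should \<open>\<phi> x\<close> be negative, so is
  \<open>h w\<close>, and \<open>- h\<close> and \<open>- x\<close> serve instead.\<close>

lemma daugavet_functional_pair:
  fixes w :: "'a::real_normed_vector" and \<phi> :: "'a \<Rightarrow>\<^sub>L real"
  assumes D: "daugavet (norm :: 'a \<Rightarrow> real)" and w: "norm w = 1" and \<phi>: "norm \<phi> = 1" and \<delta>: "0 < \<delta>" "\<delta> < 1"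
  obtains h :: "'a \<Rightarrow>\<^sub>L real" and x where "norm h \<le> 1" "h w \<ge> 1 - \<delta>" "norm x \<le> 1" "\<phi> x \<ge> 1 - \<delta>" "h x \<ge> 1 - \<delta>"
proof -
  define T where "T x = \<phi> x *\<^sub>R w" for x
  have w0: "w \<noteq> 0" using w by auto
  have nT: "norm (T x) = \<bar>\<phi> x\<bar>" for x by (simp add: T_def w)
  obtain x0 where x0: "norm x0 \<le> 1" "\<phi> x0 > 0" using blinfun_norm_witness[of 0 \<phi>] \<phi> by auto
  have "rank_one T"
    unfolding rank_one_def T_def
    by (rule dim_range_functional_scaleR[OF w0, of _ "x0 /\<^sub>R \<phi> x0"])
      (use x0 in \<open>simp_all add: blinfun.scaleR_right\<close>)
  moreover have "linear T"
    unfolding T_def by (rule linearI) (simp_all add: blinfun.add_right blinfun.scaleR_right scaleR_add_left)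
  moreover have "norm (T x) \<le> 1 * norm x" for x using norm_blinfun[of \<phi> x] by (simp add: nT \<phi>)
  ultimately have "op_norm norm (\<lambda>v. v + T v) = 1 + op_norm norm T"
    using D unfolding daugavet_def bounded_op_def by blast
  moreover have "1 \<le> op_norm norm T"
  proof (rule dense_le)
    fix s :: real assume "s < 1"
    then obtain x where x: "norm x \<le> 1" "\<phi> x > s" using blinfun_norm_witness[of s \<phi>] \<phi> by metis
    have "norm (T x) \<le> op_norm norm T"
      unfolding op_norm_def
    proof (rule cSup_upper)
      show "norm (T x) \<in> {norm (T v) |v. norm v \<le> 1}" using x(1) by blast
      show "bdd_above {norm (T v) |v. norm v \<le> 1}"
        by (rule bdd_aboveI[of _ 1]) (use blinfun_le_norm[of _ \<phi>] \<phi> nT in auto)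
    qed
    with x(2) show "s \<le> op_norm norm T" by (simp add: nT)
  qed
  ultimately have lt: "2 - \<delta> < Sup {norm (v + T v) |v. norm v \<le> 1}" using \<delta> by (simp add: op_norm_def)
  have ne: "{norm (v + T v) |v. norm v \<le> 1} \<noteq> {}" using x0(1) by blast
  obtain x where x: "norm x \<le> 1" "2 - \<delta> < norm (x + T x)"
    using less_cSupD[OF ne lt] by blast
  obtain h :: "'a \<Rightarrow>\<^sub>L real" where h: "norm h \<le> 1" "h (x + T x) = norm (x + T x)" by (rule norming_functional)
  have 1: "2 - \<delta> < h x + \<phi> x * h w"
    using x(2) h(2) by (simp add: T_def blinfun.add_right blinfun.scaleR_right)
  have bd: "\<bar>h x\<bar> \<le> 1" "\<bar>h w\<bar> \<le> 1" "\<bar>\<phi> x\<bar> \<le> 1"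
    using blinfun_le_norm[OF x(1), of h] blinfun_le_norm[of w h] blinfun_le_norm[OF x(1), of \<phi>] h(1) w \<phi> by auto
  have p1: "\<phi> x * h w \<le> \<bar>\<phi> x\<bar>" "\<phi> x * h w \<le> \<bar>h w\<bar>"
    using mult_left_mono[OF bd(2), of "\<bar>\<phi> x\<bar>"] mult_right_mono[OF bd(3), of "\<bar>h w\<bar>"] abs_le_D1[of "\<phi> x * h w"]
    by (auto simp: abs_mult)
  have p2: "1 - \<delta> < \<phi> x * h w" "1 - \<delta> < h x" using 1 bd p1 by linarith+
  then have p3: "1 - \<delta> < \<bar>\<phi> x\<bar>" "1 - \<delta> < \<bar>h w\<bar>" using p1 by linarith+
  show ?thesis
  proof (cases "\<phi> x > 0")
    case True
    have "0 < \<phi> x * h w" using p2(1) \<delta> by linarith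
    then have "h w > 0" using True by (simp add: zero_less_mult_iff)
    with True p3 p2(2) show ?thesis using that[of h x] h(1) x(1) by auto
  next
    case False
    have "0 < \<phi> x * h w" using p2(1) \<delta> by linarith
    then have "h w < 0" "\<phi> x < 0" using False by (auto simp: zero_less_mult_iff)
    with p3 p2(2) show ?thesis using that[of "- h" "- x"] h(1) x(1)
      by (auto simp: blinfun.minus_left blinfun.minus_right)
  qed
qed

text \<open>After normalising, the pair above consists of an \<open>h\<close> that almost norms
  \<open>w\<close> and a point where \<open>h\<close> and \<open>\<phi>\<close> (up to the sign of
  \<open>c\<close>) are both almost maximal, so that the norms add up there.\<close>

lemma daugavet_functional_step:
  fixes w :: "'a::real_normed_vector" and \<phi> :: "'a \<Rightarrow>\<^sub>L real" and c :: real
  assumes D: "daugavet (norm :: 'a \<Rightarrow> real)" and nt: "(x1::'a) \<noteq> 0" and e: "e > 0"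
  obtains h :: "'a \<Rightarrow>\<^sub>L real" where "norm h \<le> 1" "h w \<ge> norm w - e" "norm (\<phi> + c *\<^sub>R h) \<ge> norm \<phi> + \<bar>c\<bar> - e"
proof -
  define s :: real where "s = (if c \<ge> 0 then 1 else -1)"
  have s: "s * c = \<bar>c\<bar>" "\<bar>s\<bar> = 1" "s * s = 1" by (auto simp: s_def)
  \<comment> \<open>For \<open>w = 0\<close> or \<open>\<phi> = 0\<close> there is nothing to
    normalise; \<open>x1\<close> then supplies a unit vector or a unit functional.\<close>
  define w1 where "w1 = (if w = 0 then sgn x1 else sgn w)"
  have w1: "norm w1 = 1" "w = norm w *\<^sub>R w1"
    using nt by (simp_all add: w1_def norm_sgn scaleR_norm_sgn)
  obtain h1 :: "'a \<Rightarrow>\<^sub>L real" where h1: "norm h1 \<le> 1" "h1 (sgn x1) = norm (sgn x1)" by (rule norming_functional)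
  have "norm h1 = 1"
    using h1 blinfun_le_norm[of "sgn x1" h1] nt by (simp add: norm_sgn)
  define \<phi>1 where "\<phi>1 = (if \<phi> = 0 then h1 else s *\<^sub>R sgn \<phi>)"
  have \<phi>1: "norm \<phi>1 = 1" using \<open>norm h1 = 1\<close> s by (simp add: \<phi>1_def norm_sgn)
  have s\<phi>: "s *\<^sub>R \<phi> = norm \<phi> *\<^sub>R \<phi>1"
  proof (cases "\<phi> = 0")
    case False
    then have "norm \<phi> *\<^sub>R \<phi>1 = s *\<^sub>R (norm \<phi> *\<^sub>R sgn \<phi>)" by (simp add: \<phi>1_def)
    then show ?thesis by (simp only: scaleR_norm_sgn)
  qed simp
  \<comment> \<open>\<open>K\<close> dominates every factor by which the error
    \<open>\<delta>\<close> gets multiplied below.\<close>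
  define K where "K = 1 + norm \<phi> + \<bar>c\<bar> + norm w"
  have K: "K \<ge> 1" by (simp add: K_def)
  define \<delta> where "\<delta> = min (1/2) (e / K)"
  have \<delta>: "0 < \<delta>" "\<delta> < 1" using e K by (auto simp: \<delta>_def)
  have "\<delta> \<le> e / K" by (simp add: \<delta>_def)
  then have "K * \<delta> \<le> e" using K by (simp add: field_simps)
  moreover have "0 \<le> norm \<phi> * \<delta>" "0 \<le> \<bar>c\<bar> * \<delta>" "0 \<le> norm w * \<delta>" using \<delta> by auto
  ultimately have Ke: "norm \<phi> * \<delta> + \<bar>c\<bar> * \<delta> \<le> e" "norm w * \<delta> \<le> e"
    using \<delta>(1) unfolding K_def distrib_right mult_1 by linarith+
  obtain h x where h: "norm h \<le> 1" "blinfun_apply h w1 \<ge> 1 - \<delta>"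
    and x: "norm x \<le> 1" "blinfun_apply \<phi>1 x \<ge> 1 - \<delta>" "blinfun_apply h x \<ge> 1 - \<delta>"
    by (rule daugavet_functional_pair[OF D w1(1) \<phi>1 \<delta>])
  show ?thesis
  proof (rule that[OF h(1)])
    have "h w = norm w * h w1" by (subst w1(2)) (simp add: blinfun.scaleR_right)
    then show "h w \<ge> norm w - e"
      using mult_left_mono[OF h(2), of "norm w"] Ke(2) by (simp add: right_diff_distrib)
    have "(s *\<^sub>R (\<phi> + c *\<^sub>R h)) x = norm \<phi> * \<phi>1 x + \<bar>c\<bar> * h x"
      using s(1) by (simp add: scaleR_add_right s\<phi> blinfun.add_left blinfun.scaleR_left)
    moreover have "(s *\<^sub>R (\<phi> + c *\<^sub>R h)) x \<le> norm (\<phi> + c *\<^sub>R h)"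
      using blinfun_le_norm[OF x(1), of "s *\<^sub>R (\<phi> + c *\<^sub>R h)"] s(2) by simp
    moreover have "norm \<phi> * (1 - \<delta>) \<le> norm \<phi> * \<phi>1 x" "\<bar>c\<bar> * (1 - \<delta>) \<le> \<bar>c\<bar> * h x"
      using x by (auto intro: mult_left_mono)
    ultimately show "norm (\<phi> + c *\<^sub>R h) \<ge> norm \<phi> + \<bar>c\<bar> - e"
      using Ke(1) by (simp add: right_diff_distrib)
  qed
qed

text \<open>The functionals are chosen one at a time, each against the sum \<open>\<psi>\<close> of
  \<open>\<phi>\<close> and those already fixed. Half of the error goes to the new index and half to
  the earlier ones.\<close>

lemma daugavet_functional_family:
  fixes w :: "'i \<Rightarrow> 'a::real_normed_vector" and \<phi> :: "'a \<Rightarrow>\<^sub>L real" and c :: "'i \<Rightarrow> real"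
  assumes D: "daugavet (norm :: 'a \<Rightarrow> real)" and nt: "(x1::'a) \<noteq> 0" and "finite S" and "e > 0"
  shows "\<exists>h :: 'i \<Rightarrow> ('a \<Rightarrow>\<^sub>L real). (\<forall>i\<in>S. norm (h i) \<le> 1) \<and> (\<Sum>i\<in>S. blinfun_apply (h i) (w i)) \<ge> (\<Sum>i\<in>S. norm (w i)) - e
    \<and> norm (\<phi> + (\<Sum>i\<in>S. c i *\<^sub>R h i)) \<ge> norm \<phi> + (\<Sum>i\<in>S. \<bar>c i\<bar>) - e"
  using assms(3,4)
proof (induction S arbitrary: e rule: finite_induct)
  case empty
  then show ?case by simp
next
  case (insert j S)
  then have e: "e/2 > 0" by simp
  obtain h :: "'i \<Rightarrow> ('a \<Rightarrow>\<^sub>L real)" where h: "\<forall>i\<in>S. norm (h i) \<le> 1"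
    "(\<Sum>i\<in>S. blinfun_apply (h i) (w i)) \<ge> (\<Sum>i\<in>S. norm (w i)) - e/2"
    "norm (\<phi> + (\<Sum>i\<in>S. c i *\<^sub>R h i)) \<ge> norm \<phi> + (\<Sum>i\<in>S. \<bar>c i\<bar>) - e/2"
    using insert.IH[OF e] by blast
  define \<psi> where "\<psi> = \<phi> + (\<Sum>i\<in>S. c i *\<^sub>R h i)"
  obtain k :: "'a \<Rightarrow>\<^sub>L real" where k: "norm k \<le> 1" "k (w j) \<ge> norm (w j) - e/2"
    "norm (\<psi> + c j *\<^sub>R k) \<ge> norm \<psi> + \<bar>c j\<bar> - e/2"
    by (rule daugavet_functional_step[OF D nt e, where w = "w j" and \<phi> = \<psi> and c = "c j"])
  define h' where "h' = h(j := k)"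
  have S: "(\<Sum>i\<in>S. blinfun_apply (h' i) (w i)) = (\<Sum>i\<in>S. blinfun_apply (h i) (w i))" "(\<Sum>i\<in>S. c i *\<^sub>R h' i) = (\<Sum>i\<in>S. c i *\<^sub>R h i)"
    using insert.hyps(2) by (auto simp: h'_def intro!: sum.cong)
  have j: "h' j = k" by (simp add: h'_def)
  have ins: "\<phi> + (\<Sum>i\<in>insert j S. c i *\<^sub>R h' i) = \<psi> + c j *\<^sub>R k"
    unfolding sum.insert[OF insert.hyps] S j \<psi>_def by (simp only: ac_simps)
  show ?case
  proof (intro exI[of _ h'] conjI)
    show "\<forall>i\<in>insert j S. norm (h' i) \<le> 1" using h(1) k(1) by (simp add: h'_def)
    show "(\<Sum>i\<in>insert j S. norm (w i)) - e \<le> (\<Sum>i\<in>insert j S. h' i (w i))"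
      unfolding sum.insert[OF insert.hyps] S j using h(2) k(2) by simp
    show "norm \<phi> + (\<Sum>i\<in>insert j S. \<bar>c i\<bar>) - e \<le> norm (\<phi> + (\<Sum>i\<in>insert j S. c i *\<^sub>R h' i))"
      unfolding ins unfolding sum.insert[OF insert.hyps] using h(3) k(3) by (simp add: \<psi>_def)
  qed
qed

section \<open>Functionals on the tensor product of an L1-predual\<close>

text \<open>Through the isometry, \<open>g\<close> becomes pairing with an integrable function
  \<open>\<gamma>\<close> with values in the second factor. For a simple \<open>\<sigma>\<close>
  close to \<open>\<gamma>\<close> in mean, \<open>S\<close> holds the nonzero values of
  \<open>\<sigma>\<close> and \<open>h c\<close> represents the indicator of the level set of
  \<open>c\<close>. Disjointness of the level sets makes the norms add.\<close>

lemma L1_predual_simple_approx: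
  fixes g :: "'b::euclidean_space \<Rightarrow> ('a::real_normed_vector \<Rightarrow>\<^sub>L real)" and M :: "'m measure"
  assumes L1: "L1_predual_wrt TYPE('a) M" and g: "linear g" and e: "e > 0"
  obtains S :: "'b set" and h :: "'b \<Rightarrow> ('a \<Rightarrow>\<^sub>L real)" where "finite S"
    "\<And>b. norm (g b - (\<Sum>c\<in>S. (b \<bullet> c) *\<^sub>R h c)) \<le> e * norm b"
    "\<And>b. norm (\<Sum>c\<in>S. (b \<bullet> c) *\<^sub>R h c) = (\<Sum>c\<in>S. \<bar>b \<bullet> c\<bar> * norm (h c))"
proof -
  obtain \<Phi> :: "('a \<Rightarrow>\<^sub>L real) \<Rightarrow> ('m \<Rightarrow> real)" where
    Phi: "\<forall>f. integrable M (\<Phi> f)"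
      "\<forall>f g. AE x in M. \<Phi> (f + g) x = \<Phi> f x + \<Phi> g x"
      "\<forall>c f. AE x in M. \<Phi> (c *\<^sub>R f) x = c * \<Phi> f x"
      "\<forall>f. (\<integral>x. \<bar>\<Phi> f x\<bar> \<partial>M) = norm f"
      "\<forall>g. integrable M g \<longrightarrow> (\<exists>f. AE x in M. \<Phi> f x = g x)"
    using L1 unfolding L1_predual_wrt_def by (elim exE conjE) (rule that)
  note int = spec[OF Phi(1)] and add = Phi(2)[THEN spec, THEN spec] and scale = Phi(3)[THEN spec, THEN spec]
    and nrm = spec[OF Phi(4)] and onto = Phi(5)[THEN spec, THEN mp]
  have Phi_sum: "AE x in M. \<Phi> (\<Sum>i\<in>I. k i *\<^sub>R f i) x = (\<Sum>i\<in>I. k i * \<Phi> (f i) x)"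
    if "finite I" for I :: "'b set" and k f
    using that
  proof (induction I rule: finite_induct)
    case empty
    show ?case using scale[of 0 0] by simp
  next
    case (insert j I)
    from add[of "k j *\<^sub>R f j" "\<Sum>i\<in>I. k i *\<^sub>R f i"] scale[of "k j" "f j"] insert.IH
    show ?case
    proof eventually_elim
      case (elim x)
      then show ?case using insert.hyps by simp
    qed
  qed
  define \<gamma> where "\<gamma> x = (\<Sum>i\<in>Basis. \<Phi> (g i) x *\<^sub>R i)" for x
  have int\<gamma>: "integrable M \<gamma>"
    unfolding \<gamma>_def by (intro Bochner_Integration.integrable_sum integrable_scaleR_left int)
  have g\<gamma>: "AE x in M. \<Phi> (g b) x = b \<bullet> \<gamma> x" for b
  proof -
    have "g b = g (\<Sum>i\<in>Basis. (b \<bullet> i) *\<^sub>R i)" by (simp add: euclidean_representation)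
    also have "\<dots> = (\<Sum>i\<in>Basis. (b \<bullet> i) *\<^sub>R g i)"
      by (simp only: linear_sum[OF g] linear_scale[OF g])
    finally have gb: "g b = (\<Sum>i\<in>Basis. (b \<bullet> i) *\<^sub>R g i)" .
    have "b \<bullet> \<gamma> x = (\<Sum>i\<in>Basis. (b \<bullet> i) * \<Phi> (g i) x)" for x
      by (simp add: \<gamma>_def inner_sum_right mult.commute)
    then show ?thesis using Phi_sum[OF finite_Basis, of "\<lambda>i. b \<bullet> i" g] by (simp only: gb)
  qed
  \<comment> \<open>The definition of the Bochner integral is unfolded to get at its approximating
    simple functions.\<close>
  obtain I where "has_bochner_integral M \<gamma> I" using int\<gamma> by (auto simp: integrable.simps)
  then obtain s where s: "\<And>i. Bochner_Integration.simple_bochner_integrable M (s i)"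
    "(\<lambda>i. \<integral>\<^sup>+x. norm (\<gamma> x - s i x) \<partial>M) \<longlonglongrightarrow> 0"
    by (auto elim!: has_bochner_integral.cases)
  have "eventually (\<lambda>i. (\<integral>\<^sup>+x. norm (\<gamma> x - s i x) \<partial>M) < ennreal e) sequentially"
    using order_tendstoD(2)[OF s(2), of "ennreal e"] e by simp
  then obtain n where n: "(\<integral>\<^sup>+x. norm (\<gamma> x - s n x) \<partial>M) < ennreal e"
    using eventually_happens'[OF sequentially_bot] by blast
  define \<sigma> where "\<sigma> = s n"
  have \<sigma>: "simple_function M \<sigma>" "emeasure M {y \<in> space M. \<sigma> y \<noteq> 0} \<noteq> \<infinity>"
    using s(1)[of n] by (auto simp: \<sigma>_def simple_bochner_integrable.simps)
  have int\<sigma>: "integrable M \<sigma>"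
    using has_bochner_integral_simple_bochner_integrable[OF s(1)[of n]] unfolding \<sigma>_def
    by (rule integrable.intros)
  have int_diff: "integrable M (\<lambda>x. norm (\<gamma> x - \<sigma> x))"
    by (intro integrable_norm Bochner_Integration.integrable_diff int\<gamma> int\<sigma>)
  have "ennreal (\<integral>x. norm (\<gamma> x - \<sigma> x) \<partial>M) < ennreal e"
    using n nn_integral_eq_integral[OF int_diff] by (simp add: \<sigma>_def)
  then have small: "(\<integral>x. norm (\<gamma> x - \<sigma> x) \<partial>M) \<le> e"
    by (simp add: ennreal_less_iff)
  \<comment> \<open>Without the value 0 all level sets have finite measure, so their indicators are
    integrable.\<close>
  define S where "S = \<sigma> ` space M - {0}"
  have S: "finite S" using simple_functionD(1)[OF \<sigma>(1)] by (simp add: S_def)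
  define A where "A c = \<sigma> -` {c} \<inter> space M" for c
  have A: "A c \<in> sets M" for c unfolding A_def by (rule simple_functionD(2)[OF \<sigma>(1)])
  have intA: "integrable M (indicator (A c) :: 'm \<Rightarrow> real)" if "c \<in> S" for c
  proof (rule integrable_real_indicator[OF A])
    have "emeasure M (A c) \<le> emeasure M {y \<in> space M. \<sigma> y \<noteq> 0}"
    proof (rule emeasure_mono)
      show "A c \<subseteq> {y \<in> space M. \<sigma> y \<noteq> 0}" using that by (auto simp: A_def S_def)
      have "{y \<in> space M. \<sigma> y \<noteq> 0} = \<sigma> -` (- {0}) \<inter> space M" by auto
      then show "{y \<in> space M. \<sigma> y \<noteq> 0} \<in> sets M" using simple_functionD(2)[OF \<sigma>(1)] by simp
    qed
    with \<sigma>(2) show "emeasure M (A c) < \<infinity>" by (simp add: less_top[symmetric] top_unique) (metis top.extremum_uniqueI)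
  qed
  have "\<exists>h. \<forall>c\<in>S. AE x in M. \<Phi> (h c) x = indicator (A c) x"
    by (rule bchoice) (use onto intA in blast)
  then obtain h where h: "\<And>c. c \<in> S \<Longrightarrow> AE x in M. \<Phi> (h c) x = indicator (A c) x" by blast
  \<comment> \<open>Only the index \<open>\<sigma> x\<close> contributes at \<open>x\<close>;
    \<open>F 0 = 0\<close> covers the points where \<open>\<sigma> x\<close> is the omitted
    value.\<close>
  have ind: "(\<Sum>c\<in>S. F c * indicator (A c) x) = F (\<sigma> x)" if "x \<in> space M" "F 0 = 0" for F :: "'b \<Rightarrow> real" and x
  proof -
    have "(\<Sum>c\<in>S. F c * indicator (A c) x) = (\<Sum>c\<in>S. if c = \<sigma> x then F c else 0)"
      using that(1) by (intro sum.cong refl) (auto simp: A_def indicator_def)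
    also have "\<dots> = F (\<sigma> x)" using S that by (auto simp: sum.delta' S_def)
    finally show ?thesis .
  qed
  define T where "T b = (\<Sum>c\<in>S. (b \<bullet> c) *\<^sub>R h c)" for b
  have T: "AE x in M. \<Phi> (T b) x = b \<bullet> \<sigma> x" for b
  proof -
    have "AE x in M. \<forall>c\<in>S. \<Phi> (h c) x = indicator (A c) x"
      using h S by (simp add: AE_ball_countable countable_finite)
    with Phi_sum[OF S, of "\<lambda>c. b \<bullet> c" h] AE_space show ?thesis
    proof eventually_elim
      case (elim x)
      have "\<Phi> (T b) x = (\<Sum>c\<in>S. (b \<bullet> c) * indicator (A c) x)"
        using elim(1,3) by (simp add: T_def)
      then show ?case using ind[OF elim(2), of "\<lambda>c. b \<bullet> c"] by simp
    qed
  qed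
  have norm_h: "norm (h c) = measure M (A c)" if "c \<in> S" for c
  proof -
    have "norm (h c) = (\<integral>x. indicator (A c) x \<partial>M)"
      unfolding nrm[symmetric]
    proof (rule integral_cong_AE)
      show "AE x in M. \<bar>\<Phi> (h c) x\<bar> = indicator (A c) x" using h[OF that] by eventually_elim simp
    qed (use int[of "h c"] A in auto)
    also have "\<dots> = measure M (A c)" using sets.sets_into_space[OF A[of c]] by (simp add: Int_absorb2)
    finally show ?thesis .
  qed
  have "norm (T b) = (\<Sum>c\<in>S. \<bar>b \<bullet> c\<bar> * norm (h c))" for b
  proof -
    have "norm (T b) = (\<integral>x. (\<Sum>c\<in>S. \<bar>b \<bullet> c\<bar> * indicator (A c) x) \<partial>M)"
      unfolding nrm[symmetric]
    proof (rule integral_cong_AE)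
      show "AE x in M. \<bar>\<Phi> (T b) x\<bar> = (\<Sum>c\<in>S. \<bar>b \<bullet> c\<bar> * indicator (A c) x)"
        using T[of b] AE_space
      proof eventually_elim
        case (elim x)
        then show ?case using ind[OF elim(2), of "\<lambda>c. \<bar>b \<bullet> c\<bar>"] by simp
      qed
    qed (use int[of "T b"] A in auto)
    also have "\<dots> = (\<Sum>c\<in>S. \<integral>x. \<bar>b \<bullet> c\<bar> * indicator (A c) x \<partial>M)"
      by (intro Bochner_Integration.integral_sum integrable_mult_right intA)
    also have "\<dots> = (\<Sum>c\<in>S. \<bar>b \<bullet> c\<bar> * norm (h c))"
      using sets.sets_into_space[OF A] by (intro sum.cong refl) (simp add: norm_h Int_absorb2)
    finally show ?thesis .
  qed
  moreover have "norm (g b - T b) \<le> e * norm b" for b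
  proof -
    \<comment> \<open>The difference is written with the scalar \<open>-1\<close> so that additivity
      and homogeneity almost everywhere apply.\<close>
    have "AE x in M. \<bar>\<Phi> (g b + (-1) *\<^sub>R T b) x\<bar> \<le> norm b * norm (\<gamma> x - \<sigma> x)"
      using add[of "g b" "(-1) *\<^sub>R T b"] scale[of "-1" "T b"] T[of b] g\<gamma>[of b]
    proof eventually_elim
      case (elim x)
      then have "\<Phi> (g b + (-1) *\<^sub>R T b) x = b \<bullet> (\<gamma> x - \<sigma> x)" by (simp add: inner_diff_right)
      then show ?case by (simp only: Cauchy_Schwarz_ineq2)
    qed
    then have "norm (g b + (-1) *\<^sub>R T b) \<le> (\<integral>x. norm b * norm (\<gamma> x - \<sigma> x) \<partial>M)"
      unfolding nrm[symmetric] by (intro integral_mono_AE integrable_abs int integrable_mult_right int_diff)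
    also have "\<dots> = norm b * (\<integral>x. norm (\<gamma> x - \<sigma> x) \<partial>M)" by simp
    also have "\<dots> \<le> norm b * e" using small by (rule mult_left_mono) simp
    finally show ?thesis by (simp add: mult.commute)
  qed
  ultimately show ?thesis using that[of S h] S unfolding T_def by blast
qed

section \<open>From supporting functionals to scalar data and back\<close>

lemma blinfun_of_bounded:
  fixes f :: "'a::real_normed_vector \<Rightarrow> real"
  assumes f: "linear f" and K: "\<And>x. \<bar>f x\<bar> \<le> K * norm x"
  shows "blinfun_apply (Blinfun f) = f"
  by (rule bounded_linear_Blinfun_apply, rule bounded_linear_intro[of f K])
    (use K in \<open>simp_all add: linear_add[OF f] linear_scale[OF f] mult.commute\<close>)

lemma linear_tensor_left: "linear f \<Longrightarrow> linear (\<lambda>x. f (tensor x b))"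
  by (rule linearI) (simp_all add: tensor_simps linear_add linear_scale)

lemma linear_le_proj_norm_abs:
  fixes G :: "('b::euclidean_space \<Rightarrow>\<^sub>L 'a::real_normed_vector) \<Rightarrow> real"
  assumes G: "linear G" and le: "\<And>u. G u \<le> proj_norm u"
  shows "\<bar>G u\<bar> \<le> proj_norm u"
  using le[of u] le[of "- u"] linear_neg[OF G, of u] by (simp add: proj_norm_minus abs_le_iff)

text \<open>A functional \<open>G\<close> supporting the projective norm at
  \<open>f + tensor x y\<close> exceeds \<open>1 - \<delta>\<close> at both summands. The associated
  map \<open>g\<close> into the dual of the first factor is approximated by a simple one, and the
  norms of its functionals \<open>h i\<close> are absorbed into the vectors
  \<open>c i\<close>.\<close>

lemma tensor_decomposition:
  fixes f :: "'b::euclidean_space \<Rightarrow>\<^sub>L 'a::real_normed_vector" and M :: "'m measure"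
  assumes L1: "L1_predual_wrt TYPE('a) M" and f: "proj_norm f \<le> 1"
    and x: "norm x \<le> 1" and y: "norm y = 1" and \<delta>: "\<delta> > 0"
    and big: "proj_norm (f + tensor x y) > 2 - \<delta>"
  obtains S :: "'b set" and c :: "'b \<Rightarrow> 'b" where "finite S" "\<And>b. (\<Sum>i\<in>S. \<bar>b \<bullet> c i\<bar>) \<le> norm b"
    "(\<Sum>i\<in>S. norm (f (c i))) \<ge> 1 - 3 * \<delta>" "(\<Sum>i\<in>S. \<bar>y \<bullet> c i\<bar>) \<ge> 1 - 3 * \<delta>"
proof -
  obtain G :: "('b \<Rightarrow>\<^sub>L 'a) \<Rightarrow> real" where G: "linear G" "\<And>u. G u \<le> proj_norm u"
    "G (f + tensor x y) = proj_norm (f + tensor x y)"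
    by (rule hahn_banach_support[OF sublinear_proj_norm, of "f + tensor x y"]) blast
  have absG: "\<bar>G u\<bar> \<le> proj_norm u" for u by (rule linear_le_proj_norm_abs[OF G(1,2)])
  have "proj_norm (tensor x y) \<le> 1" using proj_norm_tensor_le[of x y] x y by simp
  moreover have "G (f + tensor x y) = G f + G (tensor x y)" by (rule linear_add[OF G(1)])
  ultimately have Gf: "G f > 1 - \<delta>" and Gxy: "G (tensor x y) > 1 - \<delta>"
    using big G(3) G(2)[of f] G(2)[of "tensor x y"] f by linarith+
  define g where "g b = Blinfun (\<lambda>x. G (tensor x b))" for b
  have bnd: "\<bar>G (tensor x b)\<bar> \<le> norm b * norm x" for x b
    using absG[of "tensor x b"] proj_norm_tensor_le[of x b] by (simp add: mult.commute)
  have g_apply: "blinfun_apply (g b) x = G (tensor x b)" for b x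
    unfolding g_def by (subst blinfun_of_bounded[OF linear_tensor_left[OF G(1)] bnd]) simp
  have g_norm: "norm (g b) \<le> norm b" for b
    by (rule norm_blinfun_bound) (simp_all add: g_apply bnd)
  have g_lin: "linear g"
    by (rule linearI; rule blinfun_eqI)
      (simp_all add: g_apply blinfun.add_left blinfun.scaleR_left tensor_simps linear_add[OF G(1)] linear_scale[OF G(1)])
  \<comment> \<open>An error \<open>e\<close> at each basis vector adds up to
    \<open>\<delta>\<close>.\<close>
  define e where "e = \<delta> / DIM('b)"
  have e: "e > 0" using \<delta> by (simp add: e_def)
  have "1 \<le> real DIM('b)" using DIM_positive[where 'a = 'b] by linarith
  then have e_le: "e \<le> \<delta>" using \<delta> by (simp add: e_def field_simps)
  obtain S :: "'b set" and h where S: "finite S"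
    and h: "\<And>b. norm (g b - (\<Sum>c\<in>S. (b \<bullet> c) *\<^sub>R h c)) \<le> e * norm b"
      "\<And>b. norm (\<Sum>c\<in>S. (b \<bullet> c) *\<^sub>R h c) = (\<Sum>c\<in>S. \<bar>b \<bullet> c\<bar> * norm (h c))"
    by (rule L1_predual_simple_approx[OF L1 g_lin e]) blast
  define T where "T b = (\<Sum>c\<in>S. (b \<bullet> c) *\<^sub>R h c)" for b
  \<comment> \<open>Dividing by \<open>1 + e\<close> offsets the approximation error, so that the
    bound by \<open>norm b\<close> holds exactly.\<close>
  define c where "c i = (norm (h i) / (1 + e)) *\<^sub>R i" for i
  have bc: "(\<Sum>i\<in>S. \<bar>b \<bullet> c i\<bar>) = norm (T b) / (1 + e)" for b
    unfolding T_def h(2) sum_divide_distrib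
    using e by (intro sum.cong refl) (simp add: c_def abs_mult mult.commute)
  have scaled: "P / (1 + e) \<ge> 1 - 3 * \<delta>" if "P \<ge> 1 - 2 * \<delta>" for P
  proof -
    have "(1 - 3 * \<delta>) * (1 + e) = 1 - 3 * \<delta> + e - 3 * (\<delta> * e)" by (simp add: algebra_simps)
    moreover have "0 \<le> \<delta> * e" using \<delta> e by simp
    ultimately have "(1 - 3 * \<delta>) * (1 + e) \<le> P" using that e_le by linarith
    then show ?thesis using e by (simp add: pos_le_divide_eq)
  qed
  show ?thesis
  proof (rule that[OF S])
    fix b
    have "norm (T b) \<le> norm (g b) + norm (g b - T b)"
      by (metis norm_triangle_sub norm_minus_commute)
    also have "\<dots> \<le> norm b + e * norm b" using g_norm[of b] h(1)[of b] by (simp add: T_def)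
    finally show "(\<Sum>i\<in>S. \<bar>b \<bullet> c i\<bar>) \<le> norm b"
      using e unfolding bc by (simp add: pos_divide_le_eq algebra_simps)
  next
    have "1 - \<delta> < norm (g y)"
      using Gxy blinfun_le_norm[OF x, of "g y"] by (simp add: g_apply)
    moreover have "norm (g y) \<le> norm (T y) + norm (g y - T y)" by (rule norm_triangle_sub)
    moreover have "norm (g y - T y) \<le> e" using h(1)[of y] y by (simp add: T_def)
    ultimately have "1 - 2 * \<delta> \<le> norm (T y)" using e_le by linarith
    then show "1 - 3 * \<delta> \<le> (\<Sum>i\<in>S. \<bar>y \<bullet> c i\<bar>)" unfolding bc by (rule scaled)
  next
    \<comment> \<open>Both \<open>G f\<close> and the sum of \<open>h i (f i)\<close> are trace
      pairings over the basis, with \<open>g\<close> and with \<open>T\<close>, and can be compared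
      term by term.\<close>
    have "G f = G (\<Sum>b\<in>Basis. tensor (f b) b)" by (rule arg_cong[OF tensor_Basis_expansion])
    also have "\<dots> = (\<Sum>b\<in>Basis. g b (f b))" by (simp add: linear_sum[OF G(1)] g_apply)
    finally have Gf_eq: "G f = (\<Sum>b\<in>Basis. g b (f b))" .
    have fi: "f i = (\<Sum>b\<in>Basis. (b \<bullet> i) *\<^sub>R f b)" for i
    proof -
      have "f i = f (\<Sum>b\<in>Basis. (i \<bullet> b) *\<^sub>R b)" by (simp add: euclidean_representation)
      then show ?thesis by (simp only: blinfun.sum_right blinfun.scaleR_right inner_commute)
    qed
    have "(\<Sum>i\<in>S. h i (f i)) = (\<Sum>i\<in>S. \<Sum>b\<in>Basis. (b \<bullet> i) * h i (f b))"
    proof (rule sum.cong[OF refl])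
      fix i
      show "h i (f i) = (\<Sum>b\<in>Basis. (b \<bullet> i) * h i (f b))"
        by (subst fi) (simp add: blinfun.sum_right blinfun.scaleR_right)
    qed
    also have "\<dots> = (\<Sum>b\<in>Basis. T b (f b))"
      by (subst sum.swap) (simp add: T_def blinfun.sum_left blinfun.scaleR_left)
    finally have hf: "(\<Sum>i\<in>S. h i (f i)) = (\<Sum>b\<in>Basis. T b (f b))" .
    have "G f - (\<Sum>i\<in>S. h i (f i)) = (\<Sum>b\<in>Basis. (g b - T b) (f b))"
      unfolding Gf_eq hf by (simp add: sum_subtractf blinfun.diff_left)
    also have "\<dots> \<le> (\<Sum>b\<in>(Basis :: 'b set). e)"
    proof (rule sum_mono)
      fix b :: 'b assume b: "b \<in> Basis"
      have "norm (f b) \<le> 1"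
        using norm_blinfun[of f b] b norm_le_proj_norm[of f] f by simp
      then have "(g b - T b) (f b) \<le> norm (g b - T b)"
        using blinfun_le_norm[of "f b" "g b - T b"] by linarith
      also have "\<dots> \<le> e" using h(1)[of b] b by (simp add: T_def)
      finally show "(g b - T b) (f b) \<le> e" .
    qed
    also have "\<dots> = \<delta>" by (simp add: e_def)
    finally have "1 - 2 * \<delta> \<le> (\<Sum>i\<in>S. h i (f i))" using Gf by linarith
    also have "\<dots> \<le> (\<Sum>i\<in>S. norm (h i) * norm (f i))"
    proof (rule sum_mono)
      show "h i (f i) \<le> norm (h i) * norm (f i)" for i
        using norm_blinfun[of "h i" "f i"] by simp
    qed
    finally have "1 - 3 * \<delta> \<le> (\<Sum>i\<in>S. norm (h i) * norm (f i)) / (1 + e)" by (rule scaled)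
    also have "\<dots> = (\<Sum>i\<in>S. norm (f (c i)))"
      unfolding sum_divide_distrib using e by (intro sum.cong refl) (simp add: c_def blinfun.scaleR_right)
    finally show "1 - 3 * \<delta> \<le> (\<Sum>i\<in>S. norm (f (c i)))" .
  qed
qed

text \<open>The decomposition is found for a reflected copy of \<open>z\<close> and transported
  back: the reflection is self-adjoint and isometric, so reflecting the vectors \<open>c i\<close>
  keeps all the estimates. Starting from \<open>\<delta>/3\<close> absorbs the factor 3.\<close>

lemma octahedral_decomposition:
  fixes z :: "'b::euclidean_space \<Rightarrow>\<^sub>L 'a::real_normed_vector" and M :: "'m measure"
  assumes L1: "L1_predual_wrt TYPE('a) M"
    and oct: "octahedral (proj_norm :: ('b \<Rightarrow>\<^sub>L 'a) \<Rightarrow> real)"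
    and z: "proj_norm z = 1" and y: "norm y = 1" and \<delta>: "\<delta> > 0"
  obtains S :: "'b set" and c :: "'b \<Rightarrow> 'b" where "finite S" "\<And>b. (\<Sum>i\<in>S. \<bar>b \<bullet> c i\<bar>) \<le> norm b"
    "(\<Sum>i\<in>S. norm (z (c i))) \<ge> 1 - \<delta>" "(\<Sum>i\<in>S. \<bar>y \<bullet> c i\<bar>) \<ge> 1 - \<delta>"
proof -
  have \<delta>3: "\<delta>/3 > 0" using \<delta> by simp
  obtain x y' v where x: "norm x \<le> 1" and y': "norm y' = 1" "hreflect v y' = y"
    and big: "proj_norm ((z o\<^sub>L breflect v) + tensor x y') > 2 - \<delta>/3"
    by (rule octahedral_reflected_tensor[OF oct z y \<delta>3])
  have "proj_norm (z o\<^sub>L breflect v) \<le> 1" by (simp add: proj_norm_breflect z)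
  then obtain S :: "'b set" and c where S: "finite S" "\<And>b. (\<Sum>i\<in>S. \<bar>b \<bullet> c i\<bar>) \<le> norm b"
    "(\<Sum>i\<in>S. norm ((z o\<^sub>L breflect v) (c i))) \<ge> 1 - 3 * (\<delta>/3)" "(\<Sum>i\<in>S. \<bar>y' \<bullet> c i\<bar>) \<ge> 1 - 3 * (\<delta>/3)"
    by (rule tensor_decomposition[OF L1 _ x y'(1) \<delta>3 big]) blast
  have y'_eq: "y' = hreflect v y" using y'(2) hreflect_involution by metis
  show ?thesis
  proof (rule that[OF S(1), where c = "\<lambda>i. hreflect v (c i)"])
    show "(\<Sum>i\<in>S. \<bar>b \<bullet> hreflect v (c i)\<bar>) \<le> norm b" for b
      using S(2)[of "hreflect v b"] by (simp add: hreflect_self_adjoint norm_hreflect)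
    show "1 - \<delta> \<le> (\<Sum>i\<in>S. norm (z (hreflect v (c i))))" using S(3) by simp
    show "1 - \<delta> \<le> (\<Sum>i\<in>S. \<bar>y \<bullet> hreflect v (c i)\<bar>)"
      using S(4) by (simp add: y'_eq hreflect_self_adjoint)
  qed
qed

text \<open>The functionals in the decomposition are exchanged for ones that almost norm
  \<open>z (c i)\<close> and whose combination \<open>\<psi>\<close> adds to \<open>\<phi>\<close>
  almost without cancellation. As \<open>G\<close> is bounded on elementary tensors through the
  vectors \<open>c i\<close> alone, it remains dominated by the projective norm.\<close>

lemma slice_functional:
  fixes z :: "'b::euclidean_space \<Rightarrow>\<^sub>L 'a::real_normed_vector" and M :: "'m measure" and \<phi> :: "'a \<Rightarrow>\<^sub>L real"
  assumes L1: "L1_predual_wrt TYPE('a) M"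
    and D: "daugavet (norm :: 'a \<Rightarrow> real)"
    and oct: "octahedral (proj_norm :: ('b \<Rightarrow>\<^sub>L 'a) \<Rightarrow> real)"
    and z: "proj_norm z = 1" and y: "norm y = 1" and \<delta>: "\<delta> > 0"
  obtains G x where "linear G" "\<And>u. G u \<le> proj_norm u" "G z \<ge> 1 - \<delta>" "norm x \<le> 1"
    "G (tensor x y) \<ge> 1 - \<delta>" "\<phi> x \<ge> norm \<phi> - \<delta>"
proof -
  have e: "\<delta>/3 > 0" using \<delta> by simp
  obtain S :: "'b set" and c where S: "finite S" "\<And>b. (\<Sum>i\<in>S. \<bar>b \<bullet> c i\<bar>) \<le> norm b"
    "(\<Sum>i\<in>S. norm (z (c i))) \<ge> 1 - \<delta>/3" "(\<Sum>i\<in>S. \<bar>y \<bullet> c i\<bar>) \<ge> 1 - \<delta>/3"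
    by (rule octahedral_decomposition[OF L1 oct z y e]) blast
  have "z \<noteq> 0" using z by (auto simp: proj_norm_zero)
  then obtain y0 where nt: "z y0 \<noteq> 0" by (metis blinfun_eqI zero_blinfun.rep_eq)
  obtain h :: "'b \<Rightarrow> ('a \<Rightarrow>\<^sub>L real)" where h: "\<forall>i\<in>S. norm (h i) \<le> 1"
    "(\<Sum>i\<in>S. blinfun_apply (h i) (z (c i))) \<ge> (\<Sum>i\<in>S. norm (z (c i))) - \<delta>/3"
    "norm (\<phi> + (\<Sum>i\<in>S. (y \<bullet> c i) *\<^sub>R h i)) \<ge> norm \<phi> + (\<Sum>i\<in>S. \<bar>y \<bullet> c i\<bar>) - \<delta>/3"
    using daugavet_functional_family[OF D nt S(1) e, of "\<lambda>i. z (c i)" \<phi> "\<lambda>i. y \<bullet> c i"]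
    by (elim exE conjE) blast
  define G where "G u = (\<Sum>i\<in>S. blinfun_apply (h i) (blinfun_apply u (c i)))" for u
  have G_lin: "linear G"
    by (rule linearI)
      (simp_all add: G_def blinfun.add_left blinfun.add_right blinfun.scaleR_left blinfun.scaleR_right
        sum.distrib sum_distrib_left)
  have G_tensor: "G (tensor a b) = (\<Sum>i\<in>S. (b \<bullet> c i) * h i a)" for a b
    by (simp add: G_def blinfun.scaleR_right)
  have G_le: "G (tensor a b) \<le> (\<Sum>i\<in>S. \<bar>b \<bullet> c i\<bar>) * norm a" for a b
    unfolding G_tensor sum_distrib_right
  proof (rule sum_mono)
    fix i assume "i \<in> S"
    then have "\<bar>h i a\<bar> \<le> norm a"
      using norm_blinfun[of "h i" a] h(1) mult_right_mono[of "norm (h i)" 1 "norm a"] by fastforce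
    then have "\<bar>(b \<bullet> c i) * h i a\<bar> \<le> \<bar>b \<bullet> c i\<bar> * norm a"
      unfolding abs_mult by (rule mult_left_mono) simp
    then show "(b \<bullet> c i) * h i a \<le> \<bar>b \<bullet> c i\<bar> * norm a" by linarith
  qed
  define \<psi> where "\<psi> = (\<Sum>i\<in>S. (y \<bullet> c i) *\<^sub>R h i)"
  have \<psi>: "\<psi> a = G (tensor a y)" for a
    by (simp add: \<psi>_def G_tensor blinfun.sum_left blinfun.scaleR_left)
  obtain x where x: "norm x \<le> 1" "(\<phi> + \<psi>) x > norm (\<phi> + \<psi>) - \<delta>/3"
    by (rule blinfun_norm_witness[of "norm (\<phi> + \<psi>) - \<delta>/3" "\<phi> + \<psi>"]) (use \<delta> in simp)
  \<comment> \<open>Since \<open>\<phi> x\<close> and \<open>G (tensor x y)\<close> cannot exceed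
    their respective bounds, a nearly maximal sum makes each of them nearly maximal.\<close>
  have 1: "\<phi> x + G (tensor x y) > norm \<phi> + (\<Sum>i\<in>S. \<bar>y \<bullet> c i\<bar>) - 2 * (\<delta>/3)"
    using x(2) h(3) by (simp add: blinfun.add_left \<psi>[symmetric]) (simp add: \<psi>_def)
  have 2: "\<phi> x \<le> norm \<phi>" using blinfun_le_norm[OF x(1), of \<phi>] by linarith
  have 3: "G (tensor x y) \<le> (\<Sum>i\<in>S. \<bar>y \<bullet> c i\<bar>)"
    using G_le[of x y] mult_left_mono[OF x(1), of "\<Sum>i\<in>S. \<bar>y \<bullet> c i\<bar>"] by (simp add: sum_nonneg)
  show ?thesis
  proof (rule that[OF G_lin])
    show "G u \<le> proj_norm u" for u
    proof (rule sublinear_le_proj_norm[OF linear_imp_sublinear[OF G_lin]])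
      fix a :: 'a and b :: 'b
      show "G (tensor a b) \<le> norm a * norm b"
        using G_le[of a b] mult_right_mono[OF S(2)[of b], of "norm a"] by (simp add: mult.commute)
    qed
    show "1 - \<delta> \<le> G z" using h(2) S(3) \<delta> by (simp add: G_def)
    show "norm x \<le> 1" by (rule x(1))
    show "1 - \<delta> \<le> G (tensor x y)" using 1 2 S(4) by linarith
    show "norm \<phi> - \<delta> \<le> \<phi> x" using 1 3 \<delta> by linarith
  qed
qed

section \<open>The Daugavet property of the tensor product\<close>

lemma rank_one_functional:
  assumes T: "linear T" and r: "rank_one T"
  obtains u \<phi> where "u \<noteq> 0" "\<And>v. T v = (\<phi> v :: real) *\<^sub>R u"
proof -
  obtain B where B: "independent B" "range T \<subseteq> span B" "card B = 1"
    using basis_exists[of "range T"] r unfolding rank_one_def by metis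
  then obtain u where u: "B = {u}" by (auto simp: card_1_singleton_iff)
  have "\<exists>k. T v = k *\<^sub>R u" for v
    using B(2) u by (auto simp: span_singleton)
  then obtain \<phi> where "\<And>v. T v = \<phi> v *\<^sub>R u" by metis
  moreover have "u \<noteq> 0" using B(1) u by auto
  ultimately show ?thesis using that by blast
qed

theorem mainTheorem5:
  fixes M :: "'m measure"
  assumes "separable_banach TYPE('a::banach)"
    and "L1_predual_wrt TYPE('a) M"
    and "daugavet (norm :: 'a \<Rightarrow> real)"
    and "octahedral (proj_norm :: ('b::euclidean_space \<Rightarrow>\<^sub>L 'a) \<Rightarrow> real)"
  shows "daugavet (proj_norm :: ('b \<Rightarrow>\<^sub>L 'a) \<Rightarrow> real)"
  unfolding daugavet_def
proof (intro allI impI)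
  fix T :: "('b \<Rightarrow>\<^sub>L 'a) \<Rightarrow> ('b \<Rightarrow>\<^sub>L 'a)"
  assume "bounded_op proj_norm T \<and> rank_one T"
  then have T: "linear T" "rank_one T" and "\<exists>K. \<forall>v. proj_norm (T v) \<le> K * proj_norm v"
    by (auto simp: bounded_op_def)
  then obtain K0 where K0: "\<And>v. proj_norm (T v) \<le> K0 * proj_norm v" by blast
  define K where "K = \<bar>K0\<bar>"
  have K: "K \<ge> 0" "proj_norm (T v) \<le> K * proj_norm v" for v
    using order_trans[OF K0[of v] mult_right_mono[OF abs_ge_self proj_norm_nonneg]] by (simp_all add: K_def)
  obtain u \<phi> where u: "u \<noteq> 0" "\<And>v. T v = \<phi> v *\<^sub>R u" by (rule rank_one_functional[OF T]) blast
  have Nu: "proj_norm u > 0" using u(1) proj_norm_eq_0D[of u] by fastforce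
  \<comment> \<open>Normalising the range vector makes the operator norm of \<open>T\<close> the
    supremum of \<open>\<bar>\<psi> v\<bar>\<close> over the unit ball.\<close>
  define z where "z = (1 / proj_norm u) *\<^sub>R u"
  define \<psi> where "\<psi> v = \<phi> v * proj_norm u" for v
  have z: "proj_norm z = 1" using Nu by (simp add: z_def proj_norm_scaleR)
  have z0: "z \<noteq> 0" using u(1) Nu by (simp add: z_def)
  have Tz: "T v = \<psi> v *\<^sub>R z" for v using Nu by (simp add: u(2) \<psi>_def z_def)
  have NT: "proj_norm (T v) = \<bar>\<psi> v\<bar>" for v by (simp add: Tz proj_norm_scaleR z)
  have \<psi>K: "\<bar>\<psi> v\<bar> \<le> K * proj_norm v" for v using K(2)[of v] by (simp only: NT)
  have \<psi>_lin: "linear \<psi>"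
  proof (rule linearI)
    fix v w
    have "\<psi> (v + w) *\<^sub>R z = (\<psi> v + \<psi> w) *\<^sub>R z"
      using linear_add[OF T(1), of v w] by (simp only: Tz scaleR_add_left)
    then show "\<psi> (v + w) = \<psi> v + \<psi> w" using z0 by simp
  next
    fix k v
    have "\<psi> (k *\<^sub>R v) *\<^sub>R z = (k * \<psi> v) *\<^sub>R z"
      using linear_scale[OF T(1), of k v] by (simp only: Tz scaleR_scaleR)
    then show "\<psi> (k *\<^sub>R v) = k *\<^sub>R \<psi> v" using z0 by simp
  qed
  define s where "s = op_norm proj_norm T"
  have s_ge: "\<bar>\<psi> v\<bar> \<le> s" if "proj_norm v \<le> 1" for v
    unfolding s_def op_norm_def
  proof (rule cSup_upper)
    show "\<bar>\<psi> v\<bar> \<in> {proj_norm (T v) |v. proj_norm v \<le> 1}" using that by (intro CollectI exI[of _ v]) (simp add: NT)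
    show "bdd_above {proj_norm (T v) |v. proj_norm v \<le> 1}"
    proof (rule bdd_aboveI[of _ K])
      fix r assume "r \<in> {proj_norm (T v) |v. proj_norm v \<le> 1}"
      then obtain v where v: "r = proj_norm (T v)" "proj_norm v \<le> 1" by blast
      show "r \<le> K" using K(2)[of v] mult_left_mono[OF v(2) K(1)] v(1) by simp
    qed
  qed
  have upper: "proj_norm (v + T v) \<le> 1 + s" if "proj_norm v \<le> 1" for v
    using proj_norm_add[of v "T v"] s_ge[OF that] that NT[of v] by linarith
  have lower: "\<exists>v. proj_norm v \<le> 1 \<and> 1 + s - \<epsilon> \<le> proj_norm (v + T v)" if \<epsilon>: "\<epsilon> > 0" for \<epsilon>
  proof -
    \<comment> \<open>The losses are \<open>3 * \<delta>\<close> in \<open>\<psi> v\<close>,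
      \<open>\<delta>\<close> in \<open>G v\<close> and \<open>K * \<delta>\<close> from replacing
      \<open>G z\<close> by 1.\<close>
    define \<delta> where "\<delta> = \<epsilon> / (4 + K)"
    have \<delta>: "\<delta> > 0" "(4 + K) * \<delta> = \<epsilon>" using \<epsilon> K(1) by (auto simp: \<delta>_def)
    have "s - \<delta> < Sup {proj_norm (T v) |v. proj_norm v \<le> 1}" using \<delta>(1) by (simp add: s_def op_norm_def)
    moreover have "proj_norm (T z) \<in> {proj_norm (T v) |v. proj_norm v \<le> 1}"
      using z by (intro CollectI exI[of _ z]) simp
    note ne = ex_in_conv[THEN iffD1, OF exI, OF this]
    ultimately obtain v0 where v0: "proj_norm v0 \<le> 1" "s - \<delta> < proj_norm (T v0)"
      using less_cSupD[OF ne, of "s - \<delta>"] by blast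
    define v1 where "v1 = sgn (\<psi> v0) *\<^sub>R v0"
    have v1: "\<psi> v1 > s - \<delta>" "proj_norm v1 \<le> 1"
      using v0 by (auto simp: v1_def linear_scale[OF \<psi>_lin] NT proj_norm_scaleR abs_sgn_eq abs_sgn mult.commute)
    \<comment> \<open>Shrinking \<open>v1\<close> by \<open>1 - \<eta>\<close> puts it into the open
      unit ball and lowers \<open>\<psi>\<close> by at most
      \<open>\<eta> * K \<le> \<delta>\<close>.\<close>
    define \<eta> where "\<eta> = min (1/2) (\<delta> / (K + 1))"
    have "0 < \<delta> / (K + 1)" using \<delta>(1) K(1) by simp
    then have \<eta>: "0 < \<eta>" "\<eta> \<le> 1/2" by (simp_all only: \<eta>_def min_less_iff_conj min.cobounded1) simp
    have "\<eta> \<le> \<delta> / (K + 1)" by (simp add: \<eta>_def)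
    then have "\<eta> * (K + 1) \<le> \<delta>" using K(1) by (simp add: field_simps)
    then have \<eta>K: "\<eta> * K \<le> \<delta>" using \<eta> by (simp add: distrib_left)
    have "proj_norm ((1 - \<eta>) *\<^sub>R v1) = (1 - \<eta>) * proj_norm v1" using \<eta> by (simp add: proj_norm_scaleR)
    also have "\<dots> \<le> (1 - \<eta>) * 1" using v1(2) \<eta> by (intro mult_left_mono) auto
    finally have lt1: "proj_norm ((1 - \<eta>) *\<^sub>R v1) < 1" using \<eta> by simp
    have "\<psi> v1 \<le> K" using \<psi>K[of v1] mult_left_mono[OF v1(2) K(1)] by simp
    then have "\<eta> * \<psi> v1 \<le> \<eta> * K" using \<eta> by simp
    then have big: "\<psi> ((1 - \<eta>) *\<^sub>R v1) > s - 2 * \<delta>"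
      using v1(1) \<eta>K by (simp add: linear_scale[OF \<psi>_lin] left_diff_distrib)
    have cvx: "convex_on UNIV \<psi>"
      by (rule convex_onI) (simp_all add: linear_add[OF \<psi>_lin] linear_scale[OF \<psi>_lin])
    have "\<exists>a b. norm a \<le> 1 \<and> norm b = 1 \<and> \<psi> (tensor a b) > s - 2 * \<delta>"
    proof (rule ccontr)
      assume "\<not> ?thesis"
      then have "\<psi> (tensor a b) \<le> s - 2 * \<delta>" if "norm a \<le> 1" "norm b = 1" for a b
        using that by (meson not_le)
      from convex_le_on_proj_ball[OF cvx lt1 this] big show False by simp
    qed
    then obtain a b where ab: "norm a \<le> 1" "norm b = 1" "\<psi> (tensor a b) > s - 2 * \<delta>" by blast
    have bnd: "\<bar>\<psi> (tensor x b)\<bar> \<le> K * norm x" for x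
      using \<psi>K[of "tensor x b"] mult_left_mono[OF proj_norm_tensor_le[of x b] K(1)] ab(2) by simp
    \<comment> \<open>The direction \<open>b\<close> is kept and \<open>a\<close> is given up:
      \<open>\<theta>\<close> measures which \<open>x\<close> leave \<open>tensor x b\<close> in the
      slice.\<close>
    define \<theta> where "\<theta> = Blinfun (\<lambda>x. \<psi> (tensor x b))"
    have \<theta>: "\<theta> x = \<psi> (tensor x b)" for x
      unfolding \<theta>_def by (subst blinfun_of_bounded[OF linear_tensor_left[OF \<psi>_lin] bnd]) simp
    have n\<theta>: "norm \<theta> > s - 2 * \<delta>" using ab(3) blinfun_le_norm[OF ab(1), of \<theta>] by (simp add: \<theta>)
    obtain G x where G: "linear G" "\<And>u. G u \<le> proj_norm u" "G z \<ge> 1 - \<delta>"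
      and x: "norm x \<le> 1" "G (tensor x b) \<ge> 1 - \<delta>" "\<theta> x \<ge> norm \<theta> - \<delta>"
      by (rule slice_functional[OF assms(2-4) z ab(2) \<delta>(1), of \<theta>]) blast
    define v where "v = tensor x b"
    have Nv: "proj_norm v \<le> 1" using proj_norm_tensor_le[of x b] x(1) ab(2) by (simp add: v_def)
    have \<psi>v: "\<psi> v \<ge> s - 3 * \<delta>" using x(3) n\<theta> by (simp add: \<theta> v_def)
    \<comment> \<open>Only the upper bound \<open>K\<close> for \<open>\<psi> v\<close> enters, so
      its sign is irrelevant.\<close>
    have "\<psi> v * (1 - G z) \<le> K * \<delta>"
    proof -
      have "\<psi> v \<le> K" using \<psi>K[of v] mult_left_mono[OF Nv K(1)] by simp
      moreover have "0 \<le> 1 - G z" "1 - G z \<le> \<delta>" using G(2)[of z] G(3) z by auto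
      ultimately show ?thesis by (meson K(1) mult_left_mono mult_right_mono order_trans)
    qed
    then have "\<psi> v * G z \<ge> \<psi> v - K * \<delta>" by (simp add: algebra_simps)
    moreover have "G (v + T v) = G v + \<psi> v * G z"
      by (simp add: Tz linear_add[OF G(1)] linear_scale[OF G(1)])
    moreover have "G v \<ge> 1 - \<delta>" using x(2) by (simp add: v_def)
    moreover have "4 * \<delta> + K * \<delta> = \<epsilon>" using \<delta>(2) by (simp add: distrib_right)
    ultimately have "1 + s - \<epsilon> \<le> proj_norm (v + T v)" using G(2)[of "v + T v"] \<psi>v by linarith
    with Nv show ?thesis by blast
  qed
  have "op_norm proj_norm (\<lambda>v. v + T v) = 1 + s"
    unfolding op_norm_def
  proof (rule antisym)
    show "Sup {proj_norm (v + T v) |v. proj_norm v \<le> 1} \<le> 1 + s"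
    proof (rule cSup_least)
      have "proj_norm (z + T z) \<in> {proj_norm (v + T v) |v. proj_norm v \<le> 1}"
        using z by (intro CollectI exI[of _ z]) simp
      then show "{proj_norm (v + T v) |v. proj_norm v \<le> 1} \<noteq> {}" by (rule ex_in_conv[THEN iffD1, OF exI])
    qed (use upper in auto)
    show "1 + s \<le> Sup {proj_norm (v + T v) |v. proj_norm v \<le> 1}"
    proof (rule field_le_epsilon)
      fix \<epsilon> :: real assume "\<epsilon> > 0"
      then obtain v where v: "proj_norm v \<le> 1" "1 + s - \<epsilon> \<le> proj_norm (v + T v)" using lower by blast
      have "proj_norm (v + T v) \<le> Sup {proj_norm (v + T v) |v. proj_norm v \<le> 1}"
      proof (rule cSup_upper)
        show "proj_norm (v + T v) \<in> {proj_norm (v + T v) |v. proj_norm v \<le> 1}" using v(1) by blast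
        show "bdd_above {proj_norm (v + T v) |v. proj_norm v \<le> 1}"
          by (rule bdd_aboveI[of _ "1 + s"]) (use upper in auto)
      qed
      with v(2) show "1 + s \<le> Sup {proj_norm (v + T v) |v. proj_norm v \<le> 1} + \<epsilon>" by linarith
    qed
  qed
  then show "op_norm proj_norm (\<lambda>v. v + T v) = 1 + op_norm proj_norm T" by (simp only: s_def)
qed

end
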